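(* Let $p_0$ be an absolutely continuous density on $\mathbb{R}$ with $i(p_0)<\infty$, and define $p_t(\cdot) := p_0(\cdot+t)$ for $t\in\mathbb{R}$. Suppose that $\psi\colon\mathbb{R}\to\mathbb{R}$ is decreasing and right-continuous, and that there exists $t_0>0$ such that $\int_\mathbb{R}\psi(z-t)^2p_0(z)\,dz<\infty$ for $t\in\{-t_0,t_0\}$. Then $\int_\mathbb{R}\psi(z)^2\bigl(\sqrt{p_t(z)} - \sqrt{p_0(z)}\bigr)^2\,dz\to0$ and $\int_\mathbb{R}(\psi(z-t) - \psi(z))^2p_0(z)\,dz\to0$ as $t\to0$. Moreover, $\varPsi(t) := \int_\mathbb{R}\psi(z-t)p_0(z)\,dz$ and $\int_\mathbb{R}p_0(z-t)\,d\psi(z)$ are finite for all $t\in[-t_0,t_0]$, and $\lim_{v\to0}\sup_{s,t\in[-v,v],\,s\ne t}\Bigl|\frac{\varPsi(t) - \varPsi(s)}{t - s} + \int_\mathbb{R}p_0\,d\psi\Bigr| = 0$, where $-\int_\mathbb{R}p_0\,d\psi = -\lim_{t\to0}\int_\mathbb{R}p_0(z-t)\,d\psi(z) = \varPsi'(0)\in[0,\infty)$.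
   Context: $i(p_0) := \int_{\{p_0>0\}}(p_0')^2/p_0$. Integrals with respect to $d\psi$ are Lebesgue–Stieltjes integrals. *)

theory Defs
  imports "HOL-Analysis.Analysis"
begin

text \<open>Absolute continuity of a real function on a set (epsilon-delta definition
  with finitely many disjoint subintervals).\<close>
definition abs_cont_on :: "real set \<Rightarrow> (real \<Rightarrow> real) \<Rightarrow> bool" where
  "abs_cont_on S f \<longleftrightarrow>
     (\<forall>e>0. \<exists>d>0. \<forall>n::nat. \<forall>a b :: nat \<Rightarrow> real.
        (\<forall>i<n. a i \<le> b i \<and> {a i..b i} \<subseteq> S) \<and>
        (\<forall>i<n. \<forall>j<n. i \<noteq> j \<longrightarrow> b i \<le> a j \<or> b j \<le> a i) \<and>
        (\<Sum>i<n. b i - a i) < d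
        \<longrightarrow> (\<Sum>i<n. \<bar>f (b i) - f (a i)\<bar>) < e)"

text \<open>Absolutely continuous on the real line: absolutely continuous on every
  compact interval.\<close>
definition abs_continuous :: "(real \<Rightarrow> real) \<Rightarrow> bool" where
  "abs_continuous f \<longleftrightarrow> (\<forall>a b. abs_cont_on {a..b} f)"

text \<open>Fisher information i(p0) = integral over {p0 > 0} of (p0')^2/p0, where p0' is
  an almost-everywhere derivative of p0.\<close>
definition fisher_info :: "(real \<Rightarrow> real) \<Rightarrow> (real \<Rightarrow> real) \<Rightarrow> ennreal" where
  "fisher_info p0 p0' = (\<integral>\<^sup>+ z. indicator {x. p0 x > 0} z * ennreal ((p0' z)\<^sup>2 / p0 z) \<partial>lborel)"

text \<open>Lebesgue--Stieltjes integral with respect to a decreasing right-continuous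
  function psi: d psi is the negative of the Lebesgue--Stieltjes measure of -psi.\<close>
definition LS_measure_dec :: "(real \<Rightarrow> real) \<Rightarrow> real measure" where
  "LS_measure_dec \<psi> = interval_measure (\<lambda>x. - \<psi> x)"

definition LS_integrable_dec :: "(real \<Rightarrow> real) \<Rightarrow> (real \<Rightarrow> real) \<Rightarrow> bool" where
  "LS_integrable_dec \<psi> f \<longleftrightarrow> integrable (LS_measure_dec \<psi>) f"

definition LS_integral_dec :: "(real \<Rightarrow> real) \<Rightarrow> (real \<Rightarrow> real) \<Rightarrow> real" where
  "LS_integral_dec \<psi> f = - (\<integral>z. f z \<partial>LS_measure_dec \<psi>)"

end

theory Submission
  imports Defs
begin

lemma abs_cont_onE:
  assumes "abs_cont_on S f" "e > 0"
  obtains d where "d > 0" "\<forall>(n::nat) a b. (\<forall>i<n. a i \<le> b i \<and> {a i..b i} \<subseteq> S) \<and>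
      (\<forall>i<n. \<forall>j<n. i \<noteq> j \<longrightarrow> b i \<le> a j \<or> b j \<le> a i) \<and>
      (\<Sum>i<n. b i - a i) < d \<longrightarrow> (\<Sum>i<n. \<bar>f (b i) - f (a i)\<bar>) < e"
  using assms(1)[unfolded abs_cont_on_def, rule_format, OF assms(2)] that by blast

lemma abs_cont_on_interval_increment:
  assumes "abs_cont_on S f" "e > 0"
  shows "\<exists>d>0. \<forall>u v. u \<le> v \<and> {u..v} \<subseteq> S \<and> v - u < d \<longrightarrow> \<bar>f v - f u\<bar> < e"
proof -
  obtain d where "d > 0" and ac: "\<forall>(n::nat) a b. (\<forall>i<n. a i \<le> b i \<and> {a i..b i} \<subseteq> S) \<and>
      (\<forall>i<n. \<forall>j<n. i \<noteq> j \<longrightarrow> b i \<le> a j \<or> b j \<le> a i) \<and>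
      (\<Sum>i<n. b i - a i) < d \<longrightarrow> (\<Sum>i<n. \<bar>f (b i) - f (a i)\<bar>) < e"
    using assms by (rule abs_cont_onE)
  have "\<bar>f v - f u\<bar> < e" if "u \<le> v" "{u..v} \<subseteq> S" "v - u < d" for u v
    using that ac[rule_format, where n=1 and a="\<lambda>_. u" and b="\<lambda>_. v"] by simp
  then show ?thesis
    using \<open>d > 0\<close> by blast
qed

lemma abs_cont_on_imp_continuous_on:
  assumes "abs_cont_on {a..b} f"
  shows "continuous_on {a..b} f"
  unfolding continuous_on_iff
proof (intro ballI allI impI)
  fix x e :: real assume x: "x \<in> {a..b}" and "e > 0"
  obtain d where "d > 0" and d: "\<forall>u v. u \<le> v \<and> {u..v} \<subseteq> {a..b} \<and> v - u < d \<longrightarrow>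
      \<bar>f v - f u\<bar> < e"
    using abs_cont_on_interval_increment[OF assms \<open>e > 0\<close>] by blast
  show "\<exists>d>0. \<forall>y\<in>{a..b}. dist y x < d \<longrightarrow> dist (f y) (f x) < e"
  proof (intro exI[of _ d] conjI ballI impI)
    fix y assume "y \<in> {a..b}" "dist y x < d"
    then show "dist (f y) (f x) < e"
      using x d[rule_format, of y x] d[rule_format, of x y] by (cases "y \<le> x") (auto simp: dist_real_def abs_minus_commute)
  qed fact
qed

lemma abs_continuous_isCont:
  assumes "abs_continuous f"
  shows "isCont f x"
proof -
  have "continuous_on {x-1..x+1} f"
    using assms unfolding abs_continuous_def by (blast intro: abs_cont_on_imp_continuous_on)
  then show ?thesis
    by (rule continuous_on_interior) auto
qed

lemma abs_continuous_imp_continuous_on: "abs_continuous f \<Longrightarrow> continuous_on S f"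
  by (simp add: abs_continuous_isCont continuous_at_imp_continuous_on)

lemma abs_cont_on_sum_measure_image_less:
  assumes ac: "abs_cont_on {a..b} f" and "e > 0"
  shows "\<exists>d>0. \<forall>(n::nat) c c'. (\<forall>i<n. c i \<le> c' i \<and> {c i..c' i} \<subseteq> {a..b}) \<and>
      (\<forall>i<n. \<forall>j<n. i \<noteq> j \<longrightarrow> c' i \<le> c j \<or> c' j \<le> c i) \<and>
      (\<Sum>i<n. c' i - c i) < d \<longrightarrow> (\<Sum>i<n. measure lebesgue (f ` {c i..c' i})) < e"
proof -
  obtain d where "d > 0" and d: "\<forall>(n::nat) a' b'. (\<forall>i<n. a' i \<le> b' i \<and> {a' i..b' i} \<subseteq> {a..b}) \<and>
      (\<forall>i<n. \<forall>j<n. i \<noteq> j \<longrightarrow> b' i \<le> a' j \<or> b' j \<le> a' i) \<and>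
      (\<Sum>i<n. b' i - a' i) < d \<longrightarrow> (\<Sum>i<n. \<bar>f (b' i) - f (a' i)\<bar>) < e"
    using assms by (rule abs_cont_onE)
  have cont: "continuous_on {a..b} f" using ac by (rule abs_cont_on_imp_continuous_on)
  have "(\<Sum>i<n. measure lebesgue (f ` {c i..c' i})) < e"
    if sub: "\<forall>i<n. c i \<le> c' i \<and> {c i..c' i} \<subseteq> {a..b}"
      and disj: "\<forall>i<n. \<forall>j<n. i \<noteq> j \<longrightarrow> c' i \<le> c j \<or> c' j \<le> c i"
      and len: "(\<Sum>i<n. c' i - c i) < d"
    for n :: nat and c c' :: "nat \<Rightarrow> real"
  proof -
    have "\<exists>u \<in> {c i..c' i}. \<exists>w \<in> {c i..c' i}. f ` {c i..c' i} \<subseteq> {f u..f w}" if i: "i < n" for i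
    proof -
      have "continuous_on {c i..c' i} f" using cont sub i continuous_on_subset by blast
      then obtain u w where "u \<in> {c i..c' i}" "w \<in> {c i..c' i}"
          "\<forall>x \<in> {c i..c' i}. f u \<le> f x" "\<forall>x \<in> {c i..c' i}. f x \<le> f w"
        using continuous_attains_inf[of "{c i..c' i}" f] continuous_attains_sup[of "{c i..c' i}" f]
          sub i by auto
      then show ?thesis by fastforce
    qed
    then obtain u w where uw: "\<And>i. i < n \<Longrightarrow> u i \<in> {c i..c' i} \<and> w i \<in> {c i..c' i} \<and>
        f ` {c i..c' i} \<subseteq> {f (u i)..f (w i)}"
      by metis
    define \<alpha> where "\<alpha> i = min (u i) (w i)" for i
    define \<beta> where "\<beta> i = max (u i) (w i)" for i
    have "(\<Sum>i<n. \<beta> i - \<alpha> i) \<le> (\<Sum>i<n. c' i - c i)"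
      using uw unfolding \<alpha>_def \<beta>_def by (intro sum_mono) fastforce
    then have osc_sum: "(\<Sum>i<n. \<bar>f (\<beta> i) - f (\<alpha> i)\<bar>) < e"
    proof (intro d[rule_format] conjI allI impI)
      fix i assume i: "i < n"
      show "\<alpha> i \<le> \<beta> i" unfolding \<alpha>_def \<beta>_def by simp
      show "{\<alpha> i..\<beta> i} \<subseteq> {a..b}"
        using uw[OF i] sub i unfolding \<alpha>_def \<beta>_def by auto
    next
      fix i j assume "i < n" "j < n" "i \<noteq> j"
      then show "\<beta> i \<le> \<alpha> j \<or> \<beta> j \<le> \<alpha> i"
        using uw[of i] uw[of j] disj[rule_format, of i j] unfolding \<alpha>_def \<beta>_def by auto
    qed (use len in simp)
    have "measure lebesgue (f ` {c i..c' i}) \<le> \<bar>f (\<beta> i) - f (\<alpha> i)\<bar>" if "i < n" for i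
    proof -
      have "f ` {c i..c' i} \<in> lmeasurable"
        using cont sub that
        by (meson compact_Icc compact_continuous_image continuous_on_subset lmeasurable_compact)
      then have "measure lebesgue (f ` {c i..c' i}) \<le> measure lebesgue {f (u i)..f (w i)}"
        using uw[OF that] by (intro measure_mono_fmeasurable) (auto intro: fmeasurableD)
      then show ?thesis
        unfolding \<alpha>_def \<beta>_def by (auto simp: min_def max_def split: if_splits)
    qed
    then have "(\<Sum>i<n. measure lebesgue (f ` {c i..c' i})) \<le> (\<Sum>i<n. \<bar>f (\<beta> i) - f (\<alpha> i)\<bar>)"
      by (intro sum_mono) simp
    with osc_sum show ?thesis
      by linarith
  qed
  then show ?thesis
    using \<open>d > 0\<close> by blast
qed

lemma disjoint_Ioo_imp_le:
  fixes a b c d :: real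
  assumes "{a<..<b} \<inter> {c<..<d} = {}" "a < b" "c < d"
  shows "b \<le> c \<or> d \<le> a"
proof (rule ccontr)
  assume "\<not> (b \<le> c \<or> d \<le> a)"
  then have "(max a c + min b d) / 2 \<in> {a<..<b} \<inter> {c<..<d}"
    using assms by auto
  then show False using assms by blast
qed

lemma abs_cont_on_sum_measure_image_family_less:
  assumes "abs_cont_on {a..b} f" "e > 0"
  shows "\<exists>d>0. \<forall>I :: real set set. finite I \<and>
       (\<forall>K\<in>I. \<exists>c c'. c < c' \<and> K = {c..c'} \<and> K \<subseteq> {a..b}) \<and>
       pairwise (\<lambda>K L. interior K \<inter> interior L = {}) I \<and>
       (\<Sum>K\<in>I. measure lebesgue K) < d \<longrightarrow> (\<Sum>K\<in>I. measure lebesgue (f ` K)) < e"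
proof -
  obtain d where "d > 0" and d: "\<forall>(n::nat) c c'. (\<forall>i<n. c i \<le> c' i \<and> {c i..c' i} \<subseteq> {a..b}) \<and>
      (\<forall>i<n. \<forall>j<n. i \<noteq> j \<longrightarrow> c' i \<le> c j \<or> c' j \<le> c i) \<and>
      (\<Sum>i<n. c' i - c i) < d \<longrightarrow> (\<Sum>i<n. measure lebesgue (f ` {c i..c' i})) < e"
    using abs_cont_on_sum_measure_image_less[OF assms] by blast
  have "(\<Sum>K\<in>I. measure lebesgue (f ` K)) < e"
    if "finite I" and intv: "\<forall>K\<in>I. \<exists>c c'. c < c' \<and> K = {c..c'} \<and> K \<subseteq> {a..b}"
      and disj: "pairwise (\<lambda>K L. interior K \<inter> interior L = {}) I"
      and len: "(\<Sum>K\<in>I. measure lebesgue K) < d"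
    for I :: "real set set"
  proof -
    obtain lo hi where lohi: "\<And>K. K \<in> I \<Longrightarrow> lo K < hi K \<and> {lo K..hi K} = K \<and> K \<subseteq> {a..b}"
      using intv by metis
    obtain g where g: "bij_betw g {..<card I} I"
      using ex_bij_betw_nat_finite[OF \<open>finite I\<close>] by (auto simp: atLeast0LessThan)
    then have gI: "g i \<in> I" if "i < card I" for i
      using that by (auto simp: bij_betw_def)
    have "(\<Sum>i<card I. measure lebesgue (f ` {lo (g i)..hi (g i)})) < e"
    proof (intro d[rule_format] conjI allI impI)
      fix i j assume ij: "i < card I" "j < card I" "i \<noteq> j"
      then have "g i \<noteq> g j"
        using g by (auto simp: bij_betw_def inj_on_def)
      then have "interior {lo (g i)..hi (g i)} \<inter> interior {lo (g j)..hi (g j)} = {}"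
        using disj gI[OF ij(1)] gI[OF ij(2)] lohi[OF gI[OF ij(1)]] lohi[OF gI[OF ij(2)]]
        unfolding pairwise_def by metis
      then have "{lo (g i)<..<hi (g i)} \<inter> {lo (g j)<..<hi (g j)} = {}"
        by (simp only: interior_atLeastAtMost_real)
      moreover have "lo (g i) < hi (g i)" "lo (g j) < hi (g j)"
        using lohi[OF gI[OF ij(1)]] lohi[OF gI[OF ij(2)]] by simp_all
      ultimately show "hi (g i) \<le> lo (g j) \<or> hi (g j) \<le> lo (g i)"
        by (rule disjoint_Ioo_imp_le)
    next
      have "(\<Sum>i<card I. hi (g i) - lo (g i)) = (\<Sum>K\<in>I. hi K - lo K)"
        using sum.reindex_bij_betw[OF g, of "\<lambda>K. hi K - lo K"] by simp
      also have "\<dots> = (\<Sum>K\<in>I. measure lebesgue K)"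
      proof (rule sum.cong)
        fix K assume "K \<in> I"
        then show "hi K - lo K = measure lebesgue K"
          using lohi[of K] by (metis less_imp_le measure_lborel_Icc measure_completion
              sets_lborel atLeastAtMost_borel)
      qed simp
      finally show "(\<Sum>i<card I. hi (g i) - lo (g i)) < d" using len by simp
    qed (use lohi gI in \<open>auto simp: less_imp_le\<close>)
    also have "(\<Sum>i<card I. measure lebesgue (f ` {lo (g i)..hi (g i)})) =
        (\<Sum>i<card I. measure lebesgue (f ` g i))"
      using lohi gI by (intro sum.cong) auto
    also have "\<dots> = (\<Sum>K\<in>I. measure lebesgue (f ` K))"
      using sum.reindex_bij_betw[OF g, of "\<lambda>K. measure lebesgue (f ` K)"] by simp
    finally show ?thesis .
  qed
  then show ?thesis
    using \<open>d > 0\<close> by blast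
qed

lemma negligible_image_abs_cont_on:
  assumes ac: "abs_cont_on {a..b} f" and N: "negligible N" "N \<subseteq> {a..b}"
  shows "negligible (f ` N)"
proof (cases "a < b")
  case False
  then have "x = a" if "x \<in> N" for x
    using N(2) that by fastforce
  then have "f ` N \<subseteq> {f a}"
    by blast
  then show ?thesis
    by (rule negligible_subset[OF negligible_sing])
next
  case True
  show ?thesis
    unfolding negligible_outer_le
  proof (intro allI impI)
    fix e :: real assume "e > 0"
    obtain d where "d > 0" and d: "\<forall>I :: real set set. finite I \<and>
        (\<forall>K\<in>I. \<exists>c c'. c < c' \<and> K = {c..c'} \<and> K \<subseteq> {a..b}) \<and>
        pairwise (\<lambda>K L. interior K \<inter> interior L = {}) I \<and>
        (\<Sum>K\<in>I. measure lebesgue K) < d \<longrightarrow> (\<Sum>K\<in>I. measure lebesgue (f ` K)) < e"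
      using abs_cont_on_sum_measure_image_family_less[OF ac \<open>e > 0\<close>] by blast
    have Nm: "N \<in> lmeasurable" "N \<subseteq> cbox a b" and N0: "measure lebesgue N = 0"
      using N negligible_imp_measurable negligible_imp_measure0 by auto
    obtain \<D> where "countable \<D>"
        and cbox: "\<And>K. K \<in> \<D> \<Longrightarrow> K \<subseteq> cbox a b \<and> K \<noteq> {} \<and> (\<exists>c d. K = cbox c d)"
        and disj: "pairwise (\<lambda>A B. interior A \<inter> interior B = {}) \<D>"
        and int: "\<And>K. K \<in> \<D> \<Longrightarrow> box a b \<noteq> {} \<Longrightarrow> interior K \<noteq> {}"
        and cover: "N \<subseteq> \<Union>\<D>" and "\<Union>\<D> \<in> lmeasurable"
        and small: "measure lebesgue (\<Union>\<D>) \<le> measure lebesgue N + d/2"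
    proof (rule measurable_outer_intervals_bounded[OF Nm, of "d/2"])
      fix \<D> assume D: "countable \<D>" "\<And>K. K \<in> \<D> \<Longrightarrow> K \<subseteq> cbox a b \<and> K \<noteq> {} \<and> (\<exists>c d. K = cbox c d)"
        "pairwise (\<lambda>A B. interior A \<inter> interior B = {}) \<D>"
        "\<And>u v. cbox u v \<in> \<D> \<Longrightarrow> \<exists>n. \<forall>i \<in> Basis. v \<bullet> i - u \<bullet> i = (b \<bullet> i - a \<bullet> i)/2^n"
        "\<And>K. K \<in> \<D> \<Longrightarrow> box a b \<noteq> {} \<Longrightarrow> interior K \<noteq> {}"
        "N \<subseteq> \<Union>\<D>" "\<Union>\<D> \<in> lmeasurable" "measure lebesgue (\<Union>\<D>) \<le> measure lebesgue N + d/2"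
      show thesis
        using that[OF D(1-3) D(5-8)] .
    qed (use \<open>d > 0\<close> in auto)
    have "\<exists>c c'. c < c' \<and> {c..c'} = K \<and> K \<subseteq> {a..b}" if K: "K \<in> \<D>" for K
    proof -
      obtain c c' where "K = {c..c'}" "K \<subseteq> {a..b}"
        using cbox[OF K] by auto
      moreover have "interior K \<noteq> {}"
        using int[OF K] True by simp
      ultimately show ?thesis by auto
    qed
    then obtain lo hi where lohi: "\<And>K. K \<in> \<D> \<Longrightarrow> lo K < hi K \<and> {lo K..hi K} = K \<and> K \<subseteq> {a..b}"
      by metis
    have intv: "\<exists>c c'. c < c' \<and> K = {c..c'} \<and> K \<subseteq> {a..b}" if "K \<in> \<D>" for K
      using lohi[OF that] by (intro exI[of _ "lo K"] exI[of _ "hi K"]) auto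
    have Km: "K \<in> lmeasurable" if "K \<in> \<D>" for K
      using lmeasurable_interval(1)[of "lo K" "hi K"] lohi[OF that] by simp
    have fK: "f ` K \<in> lmeasurable" if "K \<in> \<D>" for K
    proof -
      have "continuous_on {lo K..hi K} f"
        by (rule continuous_on_subset[OF abs_cont_on_imp_continuous_on[OF ac]])
          (use lohi[OF that] in auto)
      then have "f ` {lo K..hi K} \<in> lmeasurable"
        by (intro lmeasurable_compact compact_continuous_image compact_Icc)
      then show ?thesis
        using lohi[OF that] by simp
    qed
    have "measure lebesgue (\<Union>K\<in>I. f ` K) \<le> e" if I: "I \<subseteq> \<D>" "finite I" for I
    proof -
      have "(\<Sum>K\<in>I. measure lebesgue K) = measure lebesgue (\<Union>I)"
      proof (rule measure_negligible_finite_Union[symmetric])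
        show "K \<in> lmeasurable" if "K \<in> I" for K
          using Km that I by auto
        have "negligible (K \<inter> L)" if KL: "K \<in> I" "L \<in> I" "K \<noteq> L" for K L
        proof -
          have "interior (K \<inter> L) = {}"
            unfolding interior_Int using disj KL I(1) unfolding pairwise_def by blast
          moreover have "convex K" "convex L"
            using lohi KL I(1) convex_real_interval(5) by (metis subsetD)+
          ultimately show ?thesis
            by (simp add: negligible_convex_interior convex_Int)
        qed
        then show "pairwise (\<lambda>K L. negligible (K \<inter> L)) I"
          unfolding pairwise_def by blast
      qed (fact I)
      also have "\<dots> \<le> measure lebesgue (\<Union>\<D>)"
      proof (rule measure_mono_fmeasurable[OF _ _ \<open>\<Union>\<D> \<in> lmeasurable\<close>])
        show "\<Union>I \<subseteq> \<Union>\<D>" using I(1) by (rule Union_mono)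
        show "\<Union>I \<in> sets lebesgue"
          using I Km fmeasurableD by (intro sets.finite_Union) blast+
      qed
      also have "\<dots> < d"
        using small N0 \<open>d > 0\<close> by simp
      finally have len: "(\<Sum>K\<in>I. measure lebesgue K) < d" .
      have "(\<Sum>K\<in>I. measure lebesgue (f ` K)) < e"
      proof (intro d[rule_format] conjI ballI)
        fix K assume "K \<in> I"
        then show "\<exists>c c'. c < c' \<and> K = {c..c'} \<and> K \<subseteq> {a..b}"
          using I(1) by (intro intv) blast
      qed (use I len pairwise_subset[OF disj I(1)] in simp_all)
      moreover have "measure lebesgue (\<Union>K\<in>I. f ` K) \<le> (\<Sum>K\<in>I. measure lebesgue (f ` K))"
        using I fK by (intro measure_UNION_le) auto
      ultimately show ?thesis by simp
    qed
    note bound = this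
    have "(\<Union>K\<in>\<D>. f ` K) \<in> lmeasurable"
      by (rule fmeasurable_UN_bound[OF \<open>countable \<D>\<close> fK bound])
    moreover have "measure lebesgue (\<Union>K\<in>\<D>. f ` K) \<le> e"
      by (rule measure_UN_bound[OF \<open>countable \<D>\<close> fK bound])
    moreover have "f ` N \<subseteq> (\<Union>K\<in>\<D>. f ` K)"
      using cover by blast
    ultimately show "\<exists>T. f ` N \<subseteq> T \<and> T \<in> lmeasurable \<and> measure lebesgue T \<le> e"
      by (intro exI[of _ "\<Union>K\<in>\<D>. f ` K"]) simp
  qed
qed

lemma measure_image_le_integral_abs_deriv:
  fixes f f' :: "real \<Rightarrow> real"
  assumes D: "D \<in> sets lebesgue"
    and der: "\<And>x. x \<in> D \<Longrightarrow> (f has_real_derivative f' x) (at x within D)"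
    and int: "(\<lambda>x. \<bar>f' x\<bar>) integrable_on D"
  shows "f ` D \<in> lmeasurable \<and> measure lebesgue (f ` D) \<le> integral D (\<lambda>x. \<bar>f' x\<bar>)"
proof -
  let ?g = "\<lambda>x::real^1. (vec (f (x$1)) :: real^1)"
  let ?S = "(vec ` D :: (real^1) set)"
  have S: "?S \<in> sets lebesgue"
    by (auto intro: differentiable_image_in_sets_lebesgue [OF D] differentiable_vec)
  have "((\<lambda>x. vec (f (x $ 1))) has_derivative (*\<^sub>R) (f' z)) (at (vec z) within ?S)"
    if "z \<in> D" for z
    using der [OF that] unfolding has_real_derivative_iff_has_vector_derivative
    by (simp add: has_vector_derivative_def has_derivative_vector_1)
  then have der': "\<And>x. x \<in> ?S \<Longrightarrow> (?g has_derivative (*\<^sub>R) (f' (x$1))) (at x within ?S)"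
    by auto
  have eqf: "(\<lambda>x::real^1. \<bar>det (matrix ((*\<^sub>R) (f' (x$1))) :: real^1^1)\<bar> * 1) = (\<lambda>x. \<bar>f' (x$1)\<bar>)"
    by simp
  have img1: "(\<lambda>x. x $ 1) ` ?S = D" by (auto simp: image_iff)
  have "((\<lambda>x::real^1. \<bar>f' (x$1)\<bar>) has_integral integral D (\<lambda>x. \<bar>f' x\<bar>)) ?S"
    by (rule has_integral_vec1_D) (use int img1 in \<open>auto simp: o_def\<close>)
  then have intS: "(\<lambda>x::real^1. \<bar>det (matrix ((*\<^sub>R) (f' (x$1))) :: real^1^1)\<bar> * 1) integrable_on ?S"
    and intSv: "integral ?S (\<lambda>x::real^1. \<bar>det (matrix ((*\<^sub>R) (f' (x$1))) :: real^1^1)\<bar> * 1) = integral D (\<lambda>x. \<bar>f' x\<bar>)"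
    unfolding eqf by (auto simp: has_integral_iff)
  have R: "(\<lambda>_. 1::real) integrable_on ?g ` ?S \<and>
      integral (?g ` ?S) (\<lambda>_. 1::real) \<le> integral ?S (\<lambda>x::real^1. \<bar>det (matrix ((*\<^sub>R) (f' (x$1))) :: real^1^1)\<bar> * 1)"
    by (rule integral_on_image_ubound_nonneg[of ?S "\<lambda>_. 1::real" ?g, OF _ der' intS]) auto
  have gS: "?g ` ?S = vec ` (f ` D)" by (auto simp: image_iff)
  have img2: "(\<lambda>x. x $ 1) ` (vec ` (f ` D) :: (real^1) set) = f ` D" by (auto simp: image_iff)
  from R obtain I where I: "((\<lambda>_. 1::real) has_integral I) (vec ` (f ` D) :: (real^1) set)" and Ile: "I \<le> integral D (\<lambda>x. \<bar>f' x\<bar>)"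
    unfolding gS intSv by (auto simp: has_integral_iff)
  from has_integral_vec1_I[OF I] img2 have "((\<lambda>_. 1::real) has_integral I) (f ` D)" by (simp add: o_def)
  then have "f ` D \<in> lmeasurable" and "measure lebesgue (f ` D) = I"
    using lmeasurable_iff_integrable_on lmeasure_integral by (auto simp: has_integral_iff)
  then show ?thesis using Ile by simp
qed

lemma abs_continuous_abs_diff_le_integral:
  fixes f f' :: "real \<Rightarrow> real"
  assumes ac: "abs_continuous f" and der: "AE x in lborel. (f has_real_derivative f' x) (at x)"
    and si: "set_integrable lborel {a<..<b} (\<lambda>x. \<bar>f' x\<bar>)" and "a \<le> b"
  shows "\<bar>f b - f a\<bar> \<le> integral {a<..<b} (\<lambda>x. \<bar>f' x\<bar>)"
proof -
  let ?U = "{a<..<b}"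
  obtain N where Nd: "{x \<in> space lborel. \<not> (f has_real_derivative f' x) (at x)} \<subseteq> N"
    and Nn: "N \<in> null_sets lborel"
    using der unfolding eventually_ae_filter by blast
  define D where "D = ?U - N"
  have Db: "D \<in> sets borel"
    using Nn unfolding D_def null_sets_def by auto
  have derD: "(f has_real_derivative f' x) (at x within D)" if "x \<in> D" for x
    using Nd that unfolding D_def by (auto intro: has_field_derivative_at_within)
  have intU: "(\<lambda>x. \<bar>f' x\<bar>) integrable_on ?U"
    using set_borel_integral_eq_integral(1)[OF si] .
  have "set_integrable lborel D (\<lambda>x. \<bar>f' x\<bar>)"
    by (rule set_integrable_subset[OF si]) (use Db in \<open>auto simp: D_def\<close>)
  then have intD: "(\<lambda>x. \<bar>f' x\<bar>) integrable_on D"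
    using set_borel_integral_eq_integral(1) by blast
  have img: "f ` D \<in> lmeasurable" "measure lebesgue (f ` D) \<le> integral D (\<lambda>x. \<bar>f' x\<bar>)"
    using measure_image_le_integral_abs_deriv[OF _ derD intD] Db by auto
  have DU: "integral D (\<lambda>x. \<bar>f' x\<bar>) \<le> integral ?U (\<lambda>x. \<bar>f' x\<bar>)"
    by (rule integral_subset_le) (use intD intU in \<open>auto simp: D_def\<close>)
  have "negligible N"
    using null_sets_completionI[OF Nn] by (simp add: negligible_iff_null_sets)
  then have "negligible (N \<inter> {a..b})"
    by (rule negligible_subset) auto
  then have "negligible (f ` (N \<inter> {a..b}))"
    using ac unfolding abs_continuous_def by (blast intro: negligible_image_abs_cont_on)
  then have W: "negligible (f ` (N \<inter> {a..b}) \<union> {f a, f b})"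
    by auto
  have "f ` {a..b} \<subseteq> f ` D \<union> (f ` (N \<inter> {a..b}) \<union> {f a, f b})"
    unfolding D_def by (auto simp: less_le)
  moreover have "{min (f a) (f b)..max (f a) (f b)} \<subseteq> f ` {a..b}"
    using connected_continuous_image[OF abs_continuous_imp_continuous_on[OF ac] connected_Icc]
      \<open>a \<le> b\<close> by (intro connected_contains_Icc) (auto simp: min_def max_def)
  ultimately have cover: "{min (f a) (f b)..max (f a) (f b)} \<subseteq> f ` D \<union> (f ` (N \<inter> {a..b}) \<union> {f a, f b})"
    by blast
  have "\<bar>f b - f a\<bar> = measure lebesgue {min (f a) (f b)..max (f a) (f b)}"
    by (simp add: measure_completion) (auto simp: min_def max_def)
  also have "\<dots> \<le> measure lebesgue (f ` D \<union> (f ` (N \<inter> {a..b}) \<union> {f a, f b}))"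
  proof (rule measure_mono_fmeasurable[OF cover])
    show "f ` D \<union> (f ` (N \<inter> {a..b}) \<union> {f a, f b}) \<in> lmeasurable"
      by (rule fmeasurable.Un[OF img(1) negligible_imp_measurable[OF W]])
  qed simp
  also have "\<dots> \<le> measure lebesgue (f ` D) + measure lebesgue (f ` (N \<inter> {a..b}) \<union> {f a, f b})"
    by (intro measure_Un_le fmeasurableD img(1) negligible_imp_measurable[OF W])
  also have "\<dots> \<le> integral ?U (\<lambda>x. \<bar>f' x\<bar>)"
    using img DU negligible_imp_measure0[OF W] by linarith
  finally show ?thesis .
qed

lemma abs_continuous_abs_diff_le_nn_integral:
  fixes f f' :: "real \<Rightarrow> real"
  assumes ac: "abs_continuous f" and [measurable]: "f' \<in> borel_measurable borel"
    and der: "AE x in lborel. (f has_real_derivative f' x) (at x)" and "a \<le> b"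
  shows "ennreal \<bar>f b - f a\<bar> \<le> (\<integral>\<^sup>+x. indicator {a<..<b} x * ennreal \<bar>f' x\<bar> \<partial>lborel)"
proof (cases "(\<integral>\<^sup>+x. indicator {a<..<b} x * ennreal \<bar>f' x\<bar> \<partial>lborel) = \<infinity>")
  case False
  have nn: "(\<integral>\<^sup>+x. indicator {a<..<b} x * ennreal \<bar>f' x\<bar> \<partial>lborel) =
      (\<integral>\<^sup>+x. ennreal (norm (indicator {a<..<b} x *\<^sub>R \<bar>f' x\<bar>)) \<partial>lborel)"
    by (intro nn_integral_cong) (auto split: split_indicator)
  then have si: "set_integrable lborel {a<..<b} (\<lambda>x. \<bar>f' x\<bar>)"
    unfolding set_integrable_def integrable_iff_bounded
    using False by (auto simp: top.not_eq_extremum)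
  have "(\<integral>\<^sup>+x. indicator {a<..<b} x * ennreal \<bar>f' x\<bar> \<partial>lborel) =
      (\<integral>\<^sup>+x. ennreal (indicator {a<..<b} x * \<bar>f' x\<bar>) \<partial>lborel)"
    by (intro nn_integral_cong) (auto split: split_indicator)
  also have "\<dots> = ennreal (integral {a<..<b} (\<lambda>x. \<bar>f' x\<bar>))"
    using nn_integral_has_integral_lebesgue[of "{a<..<b}" "\<lambda>x. \<bar>f' x\<bar>"]
      set_borel_integral_eq_integral(1)[OF si] by auto
  finally show ?thesis
    using abs_continuous_abs_diff_le_integral[OF ac der si \<open>a \<le> b\<close>] by (simp add: ennreal_leI)
qed simp

lemma abs_continuous_abs_diff_le_nn_integral_between:
  fixes f f' :: "real \<Rightarrow> real"
  assumes "abs_continuous f" "f' \<in> borel_measurable borel"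
    and "AE x in lborel. (f has_real_derivative f' x) (at x)"
  shows "ennreal \<bar>f y - f x\<bar> \<le> (\<integral>\<^sup>+z. indicator {min x y<..<max x y} z * ennreal \<bar>f' z\<bar> \<partial>lborel)"
  using abs_continuous_abs_diff_le_nn_integral[OF assms, of x y]
    abs_continuous_abs_diff_le_nn_integral[OF assms, of y x]
  by (cases "x \<le> y") (auto simp: abs_minus_commute)

lemma nn_integral_dominated_convergence_at:
  fixes u :: "'b::first_countable_topology \<Rightarrow> 'a \<Rightarrow> ennreal"
  assumes [measurable]: "\<And>t. u t \<in> borel_measurable M" "u' \<in> borel_measurable M"
      "w \<in> borel_measurable M"
    and bound: "\<forall>\<^sub>F t in at a within S. AE x in M. u t x \<le> w x"
    and w: "(\<integral>\<^sup>+x. w x \<partial>M) < \<infinity>"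
    and lim: "AE x in M. ((\<lambda>t. u t x) \<longlongrightarrow> u' x) (at a within S)"
  shows "((\<lambda>t. \<integral>\<^sup>+x. u t x \<partial>M) \<longlongrightarrow> (\<integral>\<^sup>+x. u' x \<partial>M)) (at a within S)"
  unfolding tendsto_at_iff_sequentially comp_def
proof (intro allI impI)
  fix X :: "nat \<Rightarrow> 'b" assume "\<forall>i. X i \<in> S - {a}" "X \<longlonglongrightarrow> a"
  then have X: "filterlim X (at a within S) sequentially"
    by (simp add: filterlim_at)
  obtain N where N: "\<And>n. N \<le> n \<Longrightarrow> AE x in M. u (X n) x \<le> w x"
    using filterlim_iff[THEN iffD1, OF X, rule_format, OF bound]
    by (auto simp: eventually_sequentially)
  show "(\<lambda>n. \<integral>\<^sup>+x. u (X n) x \<partial>M) \<longlonglongrightarrow> (\<integral>\<^sup>+x. u' x \<partial>M)"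
  proof (rule LIMSEQ_offset[where k=N], rule nn_integral_dominated_convergence[where w=w])
    show "AE x in M. u (X (n + N)) x \<le> w x" for n
      by (rule N) simp
    show "AE x in M. (\<lambda>n. u (X (n + N)) x) \<longlonglongrightarrow> u' x"
      using lim
    proof eventually_elim
      case (elim x)
      show ?case
        by (intro LIMSEQ_ignore_initial_segment filterlim_compose[OF elim X])
    qed
  qed (use w in simp_all)
qed

lemma emeasure_punctured_ball_tendsto_0:
  fixes z :: "'a::metric_space"
  assumes M: "sets M = sets borel" and "r > 0" and fin: "emeasure M (ball z r) < \<infinity>"
  shows "((\<lambda>v. emeasure M (ball z v - {z})) \<longlongrightarrow> 0) (at_right 0)"
proof (rule tendsto_at_right_sequentially[where X="\<lambda>v. emeasure M (ball z v - {z})" and L=0,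
      OF \<open>r > 0\<close>])
  fix S :: "nat \<Rightarrow> real"
  assume S: "\<And>n. 0 < S n" "\<And>n. S n < r" "decseq S" "S \<longlonglongrightarrow> 0"
  have "(\<lambda>n. emeasure M (ball z (S n) - {z})) \<longlonglongrightarrow> emeasure M (\<Inter>n. ball z (S n) - {z})"
  proof (rule Lim_emeasure_decseq)
    show "range (\<lambda>n. ball z (S n) - {z}) \<subseteq> sets M"
      unfolding M by (auto intro: borel_open borel_closed)
    show "decseq (\<lambda>n. ball z (S n) - {z})"
      unfolding decseq_def using decseqD[OF S(3)] by (intro allI impI Diff_mono subset_ball) auto
    show "emeasure M (ball z (S n) - {z}) \<noteq> \<infinity>" for n
    proof -
      have "emeasure M (ball z (S n) - {z}) \<le> emeasure M (ball z r)"
        using S(2)[of n] M by (intro emeasure_mono) auto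
      also have "\<dots> < \<infinity>"
        by (fact fin)
      finally show ?thesis
        by simp
    qed
  qed
  moreover have "(\<Inter>n. ball z (S n) - {z}) = {}"
  proof -
    have "\<exists>n. y \<notin> ball z (S n)" if "y \<noteq> z" for y
    proof -
      have "\<forall>\<^sub>F n in sequentially. S n < dist z y"
        using that by (intro order_tendstoD(2)[OF S(4)]) simp
      then obtain n where "S n < dist z y"
        by (auto simp: eventually_sequentially)
      then show ?thesis
        by (intro exI[of _ n]) (simp add: dist_commute)
    qed
    then show ?thesis by blast
  qed
  ultimately show "(\<lambda>n. emeasure M (ball z (S n) - {z})) \<longlonglongrightarrow> 0"
    by (metis emeasure_empty)
qed

lemma ennreal_tendsto_0I:
  fixes f :: "'a \<Rightarrow> ennreal"
  assumes "\<And>e::real. e > 0 \<Longrightarrow> eventually (\<lambda>x. f x \<le> ennreal e) F"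
  shows "(f \<longlongrightarrow> 0) F"
proof (rule order_tendstoI)
  fix a :: ennreal assume "a < 0" then show "eventually (\<lambda>x. a < f x) F" by simp
next
  fix a :: ennreal assume "0 < a"
  then obtain b where b: "0 < b" "b < a" using dense by blast
  then have "b \<noteq> top" using top.not_eq_extremum by fastforce
  then have be: "b = ennreal (enn2real b)" by (cases b) auto
  have "enn2real b > 0" using b \<open>b \<noteq> top\<close> by (simp add: enn2real_positive_iff less_top)
  then have "eventually (\<lambda>x. f x \<le> ennreal (enn2real b)) F" by (rule assms)
  then show "eventually (\<lambda>x. f x < a) F"
    by (rule eventually_mono) (use b be in \<open>metis le_less_trans\<close>)
qed

lemma sqrt_diff_square_le:
  fixes a b :: real assumes "0 \<le> a" "0 \<le> b"
  shows "(sqrt a - sqrt b)\<^sup>2 \<le> \<bar>a - b\<bar>" "(sqrt a - sqrt b)\<^sup>2 \<le> a + b"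
proof -
  let ?x = "sqrt a" and ?y = "sqrt b"
  have x: "?x \<ge> 0" "?x\<^sup>2 = a" and y: "?y \<ge> 0" "?y\<^sup>2 = b" using assms by auto
  have "(?x - ?y)\<^sup>2 = \<bar>?x - ?y\<bar> * \<bar>?x - ?y\<bar>" by (simp add: power2_eq_square abs_mult_self_eq)
  also have "\<dots> \<le> \<bar>?x - ?y\<bar> * (?x + ?y)"
  proof (rule mult_left_mono)
    show "\<bar>?x - ?y\<bar> \<le> ?x + ?y" using x y by (simp add: abs_le_iff)
  qed simp
  also have "\<dots> = \<bar>(?x - ?y) * (?x + ?y)\<bar>" using x y by (simp add: abs_mult)
  also have "(?x - ?y) * (?x + ?y) = ?x\<^sup>2 - ?y\<^sup>2" by (simp add: power2_eq_square algebra_simps)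
  finally show "(sqrt a - sqrt b)\<^sup>2 \<le> \<bar>a - b\<bar>" using x y by simp
  have "(?x - ?y)\<^sup>2 = ?x\<^sup>2 + ?y\<^sup>2 - 2 * ?x * ?y" by (simp add: power2_eq_square algebra_simps)
  also have "\<dots> \<le> ?x\<^sup>2 + ?y\<^sup>2" using x y by simp
  finally show "(sqrt a - sqrt b)\<^sup>2 \<le> a + b" using x y by simp
qed

lemma mult_le_truncation:
  fixes a b c D M :: real
  assumes "0 \<le> M" "0 \<le> D" "D \<le> \<bar>a - b\<bar>" "D \<le> a + b" "0 \<le> c"
  shows "c * D \<le> M * \<bar>a - b\<bar> + max 0 (c - M) * (a + b)"
proof -
  have "c = min c M + max 0 (c - M)" by (auto simp: min_def max_def)
  then have "c * D = min c M * D + max 0 (c - M) * D" by (metis distrib_right)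
  also have "min c M * D \<le> M * \<bar>a - b\<bar>"
    using assms by (intro mult_mono) auto
  also have "max 0 (c - M) * D \<le> max 0 (c - M) * (a + b)"
    using assms by (intro mult_left_mono) auto
  finally show ?thesis by simp
qed

lemma ennreal_le_add_abs_diff: "ennreal (x::real) \<le> ennreal y + ennreal \<bar>x - y\<bar>"
proof (cases "y \<ge> 0")
  case True
  then have "ennreal y + ennreal \<bar>x - y\<bar> = ennreal (y + \<bar>x - y\<bar>)" by (simp add: ennreal_plus)
  moreover have "ennreal x \<le> ennreal (y + \<bar>x - y\<bar>)" by (intro ennreal_leI) linarith
  ultimately show ?thesis by simp
next
  case False
  then have a: "ennreal x \<le> ennreal \<bar>x - y\<bar>" by (intro ennreal_leI) linarith
  have "ennreal y = 0" using False by (simp add: ennreal_neg)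
  then show ?thesis using a by simp
qed

lemma sets_LS_measure_dec [simp, measurable_cong]: "sets (LS_measure_dec \<psi>) = sets borel"
  by (simp add: LS_measure_dec_def)

lemma space_LS_measure_dec [simp]: "space (LS_measure_dec \<psi>) = UNIV"
  by (simp add: LS_measure_dec_def)

lemma emeasure_LS_measure_dec_Ioc:
  assumes "antimono \<psi>" "\<And>x. continuous (at_right x) \<psi>" "a \<le> b"
  shows "emeasure (LS_measure_dec \<psi>) {a<..b} = ennreal (\<psi> a - \<psi> b)"
  using emeasure_interval_measure_Ioc[OF \<open>a \<le> b\<close>, of "\<lambda>x. - \<psi> x"] assms
  by (auto simp: LS_measure_dec_def antimono_def intro: continuous_minus)

lemma sigma_finite_LS_measure_dec:
  assumes "antimono \<psi>" "\<And>x. continuous (at_right x) \<psi>"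
  shows "sigma_finite_measure (LS_measure_dec \<psi>)"
  unfolding LS_measure_dec_def using assms
  by (intro sigma_finite_interval_measure) (auto simp: antimono_def intro: continuous_minus)

lemma AE_deriv_eq_0_at_zeros:
  fixes p dp :: "real \<Rightarrow> real"
  assumes "\<And>z. p z \<ge> 0" and "AE z in lborel. (p has_real_derivative dp z) (at z)"
  shows "AE z in lborel. p z = 0 \<longrightarrow> dp z = 0"
  using assms(2)
proof eventually_elim
  case (elim z)
  show ?case
  proof
    assume "p z = 0"
    then show "dp z = 0"
      using assms(1) by (intro DERIV_local_min[OF elim, of 1]) auto
  qed
qed

lemma abs_mult_le_div_add_mult:
  fixes c d p :: real
  assumes "p > 0"
  shows "\<bar>d\<bar> * \<bar>c\<bar> \<le> d\<^sup>2 / p + c\<^sup>2 * p"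
proof -
  have "0 \<le> (\<bar>d\<bar> - \<bar>c\<bar> * p)\<^sup>2 / p"
    using assms by simp
  also have "\<dots> = d\<^sup>2 / p + c\<^sup>2 * p - 2 * (\<bar>d\<bar> * \<bar>c\<bar>)"
    using assms by (simp add: field_simps power2_eq_square)
  finally show ?thesis
    by (smt (verit) mult_nonneg_nonneg abs_ge_zero)
qed

lemma nn_integral_abs_mult_le_fisher_info:
  fixes p dp c :: "real \<Rightarrow> real"
  assumes [measurable]: "p \<in> borel_measurable borel" "dp \<in> borel_measurable borel"
      "c \<in> borel_measurable borel"
    and p: "\<And>z. p z \<ge> 0" and dp0: "AE z in lborel. p z = 0 \<longrightarrow> dp z = 0"
  shows "(\<integral>\<^sup>+z. ennreal (\<bar>dp z\<bar> * \<bar>c z\<bar>) \<partial>lborel) \<le>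
    fisher_info p dp + (\<integral>\<^sup>+z. ennreal ((c z)\<^sup>2 * p z) \<partial>lborel)"
proof -
  have "(\<integral>\<^sup>+z. ennreal (\<bar>dp z\<bar> * \<bar>c z\<bar>) \<partial>lborel) \<le>
      (\<integral>\<^sup>+z. indicator {x. p x > 0} z * ennreal ((dp z)\<^sup>2 / p z) + ennreal ((c z)\<^sup>2 * p z) \<partial>lborel)"
    using dp0
  proof (intro nn_integral_mono_AE, eventually_elim)
    case (elim z)
    show ?case
    proof (cases "p z > 0")
      case True
      then show ?thesis
        using abs_mult_le_div_add_mult[OF True, of "dp z" "c z"] p[of z]
        by (simp add: ennreal_plus[symmetric] del: ennreal_plus)
    next
      case False
      then show ?thesis
        using elim p[of z] by simp
    qed
  qed
  also have "\<dots> = fisher_info p dp + (\<integral>\<^sup>+z. ennreal ((c z)\<^sup>2 * p z) \<partial>lborel)"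
    unfolding fisher_info_def by (intro nn_integral_add) auto
  finally show ?thesis .
qed

lemma nn_integral_abs_diff_shift_le:
  fixes f f' :: "real \<Rightarrow> real"
  assumes "abs_continuous f" and [measurable]: "f' \<in> borel_measurable borel"
    and "AE x in lborel. (f has_real_derivative f' x) (at x)"
  shows "(\<integral>\<^sup>+ z. ennreal \<bar>f (z + t) - f z\<bar> \<partial>lborel) \<le> ennreal \<bar>t\<bar> * (\<integral>\<^sup>+ w. ennreal \<bar>f' w\<bar> \<partial>lborel)"
proof -
  let ?S = "{x::real\<times>real. min (fst x) (fst x + t) < snd x \<and> snd x < max (fst x) (fst x + t)}"
  have m: "(\<lambda>(z,w). indicator ?S (z,w) * ennreal \<bar>f' w\<bar>) \<in> borel_measurable (lborel \<Otimes>\<^sub>M lborel)"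
    by measurable
  have "(\<integral>\<^sup>+ z. ennreal \<bar>f (z + t) - f z\<bar> \<partial>lborel) \<le> (\<integral>\<^sup>+ z. (\<integral>\<^sup>+ w. indicator ?S (z,w) * ennreal \<bar>f' w\<bar> \<partial>lborel) \<partial>lborel)"
  proof (intro nn_integral_mono)
    fix z
    have "ennreal \<bar>f (z + t) - f z\<bar> \<le> (\<integral>\<^sup>+w. indicator {min z (z + t)<..<max z (z + t)} w * ennreal \<bar>f' w\<bar> \<partial>lborel)"
      using assms by (rule abs_continuous_abs_diff_le_nn_integral_between)
    also have "\<dots> = (\<integral>\<^sup>+ w. indicator ?S (z,w) * ennreal \<bar>f' w\<bar> \<partial>lborel)"
      by (intro nn_integral_cong) (auto split: split_indicator)
    finally show "ennreal \<bar>f (z + t) - f z\<bar> \<le> (\<integral>\<^sup>+ w. indicator ?S (z,w) * ennreal \<bar>f' w\<bar> \<partial>lborel)" .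
  qed
  also have "\<dots> = (\<integral>\<^sup>+ w. (\<integral>\<^sup>+ z. indicator ?S (z,w) * ennreal \<bar>f' w\<bar> \<partial>lborel) \<partial>lborel)"
    by (rule lborel_pair.Fubini'[OF m, symmetric])
  also have "\<dots> = (\<integral>\<^sup>+ w. ennreal \<bar>f' w\<bar> * ennreal \<bar>t\<bar> \<partial>lborel)"
  proof (intro nn_integral_cong)
    fix w :: real
    have "(\<integral>\<^sup>+ z. indicator ?S (z,w) * ennreal \<bar>f' w\<bar> \<partial>lborel) =
          (\<integral>\<^sup>+ z. ennreal \<bar>f' w\<bar> * indicator {w - max 0 t<..<w - min 0 t} z \<partial>lborel)"
      by (intro nn_integral_cong) (auto split: split_indicator simp: min_def max_def)
    also have "\<dots> = ennreal \<bar>f' w\<bar> * emeasure lborel {w - max 0 t<..<w - min 0 t}"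
      by (rule nn_integral_cmult_indicator) simp
    also have "emeasure lborel {w - max 0 t<..<w - min 0 t} = ennreal \<bar>t\<bar>"
      by (subst emeasure_lborel_Ioo) (auto simp: min_def max_def)
    finally show "(\<integral>\<^sup>+ z. indicator ?S (z,w) * ennreal \<bar>f' w\<bar> \<partial>lborel) = ennreal \<bar>f' w\<bar> * ennreal \<bar>t\<bar>" .
  qed
  also have "\<dots> = ennreal \<bar>t\<bar> * (\<integral>\<^sup>+ w. ennreal \<bar>f' w\<bar> \<partial>lborel)"
    by (subst nn_integral_multc) (auto simp: mult.commute)
  finally show ?thesis .
qed

lemma nn_integral_excess_less:
  fixes h p :: "'a \<Rightarrow> real"
  assumes [measurable]: "h \<in> borel_measurable M" "p \<in> borel_measurable M"
    and "\<And>x. h x \<ge> 0" "\<And>x. p x \<ge> 0"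
    and fin: "(\<integral>\<^sup>+x. ennreal (h x * p x) \<partial>M) < \<infinity>" and "e > 0"
  shows "\<exists>C\<ge>0. (\<integral>\<^sup>+x. ennreal (max 0 (h x - C) * p x) \<partial>M) < ennreal e"
proof -
  have "(\<lambda>n. \<integral>\<^sup>+x. ennreal (max 0 (h x - real n) * p x) \<partial>M) \<longlonglongrightarrow> (\<integral>\<^sup>+x. 0 \<partial>M)"
  proof (rule nn_integral_dominated_convergence[where w="\<lambda>x. ennreal (h x * p x)"])
    show "AE x in M. ennreal (max 0 (h x - real n) * p x) \<le> ennreal (h x * p x)" for n
      using assms by (intro AE_I2 ennreal_leI mult_right_mono) auto
    show "AE x in M. (\<lambda>n. ennreal (max 0 (h x - real n) * p x)) \<longlonglongrightarrow> 0"
    proof (intro AE_I2 tendsto_eventually)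
      fix x
      obtain N :: nat where "h x < N"
        using reals_Archimedean2 by blast
      then have "ennreal (max 0 (h x - real n) * p x) = 0" if "N \<le> n" for n
        using that by simp
      then show "\<forall>\<^sub>F n in sequentially. ennreal (max 0 (h x - real n) * p x) = 0"
        unfolding eventually_sequentially by blast
    qed
  qed (use fin in simp_all)
  then have "\<forall>\<^sub>F n in sequentially. (\<integral>\<^sup>+x. ennreal (max 0 (h x - real n) * p x) \<partial>M) < ennreal e"
    using \<open>e > 0\<close> by (intro order_tendstoD(2)) auto
  then obtain n where "(\<integral>\<^sup>+x. ennreal (max 0 (h x - real n) * p x) \<partial>M) < ennreal e"
    by (auto simp: eventually_sequentially)
  then show ?thesis
    by (intro exI[of _ "real n"]) simp
qed

lemma filterlim_abs_at_right_0: "filterlim abs (at_right (0::real)) (at 0)"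
  unfolding filterlim_at
  by (auto simp: eventually_at_filter intro: tendsto_rabs_zero tendsto_ident_at)

locale fisher_density =
  fixes p dp :: "real \<Rightarrow> real"
  assumes p_nonneg: "\<And>z. p z \<ge> 0"
    and p_integrable: "integrable lborel p"
    and p_integral: "(\<integral>z. p z \<partial>lborel) = 1"
    and p_abs_continuous: "abs_continuous p"
    and dp_measurable [measurable]: "dp \<in> borel_measurable borel"
    and p_deriv: "AE z in lborel. (p has_real_derivative dp z) (at z)"
    and fisher_info_finite: "fisher_info p dp < \<infinity>"
begin

lemma p_isCont: "isCont p x"
  using p_abs_continuous by (rule abs_continuous_isCont)

lemma p_measurable [measurable]: "p \<in> borel_measurable borel"
  by (rule borel_measurable_continuous_onI) (simp add: continuous_at_imp_continuous_on p_isCont)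

lemma nn_integral_p: "(\<integral>\<^sup>+z. ennreal (p z) \<partial>lborel) = 1"
  using nn_integral_eq_integral[OF p_integrable] p_nonneg p_integral by simp

lemma nn_integral_abs_dp_mult_le:
  assumes [measurable]: "c \<in> borel_measurable borel"
  shows "(\<integral>\<^sup>+z. ennreal (\<bar>dp z\<bar> * \<bar>c z\<bar>) \<partial>lborel) \<le>
    fisher_info p dp + (\<integral>\<^sup>+z. ennreal ((c z)\<^sup>2 * p z) \<partial>lborel)"
  using p_nonneg AE_deriv_eq_0_at_zeros[OF p_nonneg p_deriv]
  by (intro nn_integral_abs_mult_le_fisher_info) simp_all

lemma nn_integral_abs_dp_finite: "(\<integral>\<^sup>+z. ennreal \<bar>dp z\<bar> \<partial>lborel) < \<infinity>"
proof -
  have "(\<integral>\<^sup>+z. ennreal \<bar>dp z\<bar> \<partial>lborel) \<le> fisher_info p dp + (\<integral>\<^sup>+z. ennreal (1\<^sup>2 * p z) \<partial>lborel)"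
    using nn_integral_abs_dp_mult_le[of "\<lambda>_. 1"] by simp
  also have "\<dots> < \<infinity>"
    using fisher_info_finite nn_integral_p by (simp add: less_top)
  finally show ?thesis .
qed

lemma nn_integral_abs_shift_diff_le:
  "(\<integral>\<^sup>+ z. ennreal \<bar>p (z + t) - p z\<bar> \<partial>lborel) \<le> ennreal \<bar>t\<bar> * (\<integral>\<^sup>+ w. ennreal \<bar>dp w\<bar> \<partial>lborel)"
  using p_abs_continuous dp_measurable p_deriv by (rule nn_integral_abs_diff_shift_le)

definition local_var :: "real \<Rightarrow> real \<Rightarrow> ennreal" where
  "local_var v y = (\<integral>\<^sup>+ w. indicator (ball y v) w * ennreal \<bar>dp w\<bar> \<partial>lborel)"

lemma local_var_measurable [measurable]: "local_var v \<in> borel_measurable borel"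
proof -
  have "(\<lambda>y. \<integral>\<^sup>+ w. indicator {x::real\<times>real. dist (fst x) (snd x) < v} (y, w) * ennreal \<bar>dp w\<bar> \<partial>lborel)
      \<in> borel_measurable borel"
    by (rule lborel.borel_measurable_nn_integral) measurable
  moreover have "(\<lambda>y. \<integral>\<^sup>+ w. indicator {x::real\<times>real. dist (fst x) (snd x) < v} (y, w) * ennreal \<bar>dp w\<bar> \<partial>lborel) =
      local_var v"
    unfolding local_var_def by (intro ext nn_integral_cong) (auto split: split_indicator simp: dist_commute)
  ultimately show ?thesis by simp
qed

lemma abs_diff_le_local_var:
  assumes "dist y a \<le> v" "dist y b \<le> v"
  shows "ennreal \<bar>p b - p a\<bar> \<le> local_var v y"
proof -
  have "ennreal \<bar>p b - p a\<bar> \<le> (\<integral>\<^sup>+z. indicator {min a b<..<max a b} z * ennreal \<bar>dp z\<bar> \<partial>lborel)"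
    using p_abs_continuous dp_measurable p_deriv by (rule abs_continuous_abs_diff_le_nn_integral_between)
  also have "\<dots> \<le> local_var v y"
    unfolding local_var_def
  proof (intro nn_integral_mono)
    fix w
    have "{min a b<..<max a b} \<subseteq> ball y v"
      using assms by (auto simp: dist_real_def min_def max_def)
    then show "indicator {min a b<..<max a b} w * ennreal \<bar>dp w\<bar> \<le> indicator (ball y v) w * ennreal \<bar>dp w\<bar>"
      by (auto split: split_indicator)
  qed
  finally show ?thesis .
qed

end

locale fisher_density_psi = fisher_density +
  fixes \<psi> :: "real \<Rightarrow> real" and t0 :: real
  assumes psi_antimono: "antimono \<psi>"
    and psi_right_cont: "\<And>x. continuous (at_right x) \<psi>"
    and t0_pos: "t0 > 0"
    and psi_sq_finite: "\<And>t. t \<in> {-t0, t0} \<Longrightarrow> (\<integral>\<^sup>+ z. ennreal ((\<psi> (z - t))\<^sup>2 * p z) \<partial>lborel) < \<infinity>"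
begin

abbreviation \<mu> :: "real measure" where
  "\<mu> \<equiv> LS_measure_dec \<psi>"

lemma psi_le: "x \<le> y \<Longrightarrow> \<psi> y \<le> \<psi> x"
  using psi_antimono by (auto simp: antimono_def)

lemma psi_measurable [measurable]: "\<psi> \<in> borel_measurable borel"
proof -
  have "(\<lambda>x. - \<psi> x) \<in> borel_measurable borel"
    by (rule borel_measurable_mono) (auto simp: mono_def psi_le)
  then have "(\<lambda>x. - (- \<psi> x)) \<in> borel_measurable borel"
    by measurable
  then show ?thesis by simp
qed

lemma emeasure_mu_Ioc: "a \<le> b \<Longrightarrow> emeasure \<mu> {a<..b} = ennreal (\<psi> a - \<psi> b)"
  using psi_antimono psi_right_cont by (rule emeasure_LS_measure_dec_Ioc)

lemma sigma_finite_mu: "sigma_finite_measure \<mu>"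
  using psi_antimono psi_right_cont by (rule sigma_finite_LS_measure_dec)

lemma pair_sigma_finite_mu: "pair_sigma_finite \<mu> lborel"
  unfolding pair_sigma_finite_def using sigma_finite_mu lborel.sigma_finite_measure_axioms by auto

definition env :: "real \<Rightarrow> real" where
  "env z = \<bar>\<psi> (z - t0)\<bar> + \<bar>\<psi> (z + t0)\<bar>"

lemma env_measurable [measurable]: "env \<in> borel_measurable borel"
  unfolding env_def by measurable

lemma env_nonneg: "env z \<ge> 0"
  unfolding env_def by simp

lemma abs_psi_le_env: "\<bar>t\<bar> \<le> t0 \<Longrightarrow> \<bar>\<psi> (z - t)\<bar> \<le> env z"
  using psi_le[of "z - t0" "z - t"] psi_le[of "z - t" "z + t0"] unfolding env_def by linarith

lemma nn_integral_env_sq_finite: "(\<integral>\<^sup>+z. ennreal ((env z)\<^sup>2 * p z) \<partial>lborel) < \<infinity>"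
proof -
  let ?a = "\<lambda>z. (\<psi> (z - t0))\<^sup>2 * p z" and ?b = "\<lambda>z. (\<psi> (z + t0))\<^sup>2 * p z"
  have "(\<integral>\<^sup>+z. ennreal ((env z)\<^sup>2 * p z) \<partial>lborel) \<le>
      (\<integral>\<^sup>+z. ennreal (2 * ?a z) + ennreal (2 * ?b z) \<partial>lborel)"
  proof (intro nn_integral_mono)
    fix z
    have "0 \<le> (\<bar>\<psi> (z - t0)\<bar> - \<bar>\<psi> (z + t0)\<bar>)\<^sup>2"
      by simp
    then have "(env z)\<^sup>2 \<le> 2 * (\<psi> (z - t0))\<^sup>2 + 2 * (\<psi> (z + t0))\<^sup>2"
      unfolding env_def by (simp add: power2_eq_square algebra_simps abs_mult_self_eq)
    from mult_right_mono[OF this p_nonneg[of z]]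
    have "(env z)\<^sup>2 * p z \<le> 2 * ?a z + 2 * ?b z"
      by (simp add: algebra_simps)
    moreover have "ennreal (2 * ?a z) + ennreal (2 * ?b z) = ennreal (2 * ?a z + 2 * ?b z)"
      using p_nonneg[of z] by (intro ennreal_plus[symmetric]) auto
    ultimately show "ennreal ((env z)\<^sup>2 * p z) \<le> ennreal (2 * ?a z) + ennreal (2 * ?b z)"
      by (simp only: ennreal_leI)
  qed
  also have "\<dots> = 2 * (\<integral>\<^sup>+z. ennreal (?a z) \<partial>lborel) + 2 * (\<integral>\<^sup>+z. ennreal (?b z) \<partial>lborel)"
    by (simp add: nn_integral_add ennreal_mult' nn_integral_cmult)
  also have "\<dots> < \<infinity>"
    using psi_sq_finite[of t0] psi_sq_finite[of "-t0"] by (simp add: ennreal_mult_less_top less_top)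
  finally show ?thesis .
qed

lemma nn_integral_env_finite: "(\<integral>\<^sup>+z. ennreal (env z * p z) \<partial>lborel) < \<infinity>"
proof -
  have "(\<integral>\<^sup>+z. ennreal (env z * p z) \<partial>lborel) \<le>
      (\<integral>\<^sup>+z. ennreal ((env z)\<^sup>2 * p z) + ennreal (p z) \<partial>lborel)"
  proof (intro nn_integral_mono)
    fix z
    have "0 \<le> (env z - 1/2)\<^sup>2"
      by simp
    then have "env z \<le> (env z)\<^sup>2 + 1"
      by (simp add: power2_eq_square algebra_simps)
    from mult_right_mono[OF this p_nonneg[of z]]
    have "env z * p z \<le> (env z)\<^sup>2 * p z + p z"
      by (simp add: algebra_simps)
    then show "ennreal (env z * p z) \<le> ennreal ((env z)\<^sup>2 * p z) + ennreal (p z)"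
      using p_nonneg[of z] by (simp add: ennreal_plus[symmetric] del: ennreal_plus)
  qed
  also have "\<dots> < \<infinity>"
    using nn_integral_env_sq_finite nn_integral_p by (simp add: nn_integral_add less_top)
  finally show ?thesis .
qed

lemma nn_integral_abs_dp_env_finite: "(\<integral>\<^sup>+z. ennreal (\<bar>dp z\<bar> * env z) \<partial>lborel) < \<infinity>"
proof -
  have "(\<integral>\<^sup>+z. ennreal (\<bar>dp z\<bar> * env z) \<partial>lborel) \<le>
      fisher_info p dp + (\<integral>\<^sup>+z. ennreal ((env z)\<^sup>2 * p z) \<partial>lborel)"
    using nn_integral_abs_dp_mult_le[of env] env_nonneg by simp
  also have "\<dots> < \<infinity>"
    using fisher_info_finite nn_integral_env_sq_finite by (simp add: less_top)
  finally show ?thesis .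
qed

lemma integrable_psi_shift:
  assumes "\<bar>t\<bar> \<le> t0"
  shows "integrable lborel (\<lambda>z. \<psi> (z - t) * p z)"
  unfolding integrable_iff_bounded
proof
  show "(\<lambda>z. \<psi> (z - t) * p z) \<in> borel_measurable lborel"
    by measurable
  have "(\<integral>\<^sup>+ z. ennreal (norm (\<psi> (z - t) * p z)) \<partial>lborel) \<le> (\<integral>\<^sup>+z. ennreal (env z * p z) \<partial>lborel)"
    using abs_psi_le_env[OF assms] p_nonneg
    by (intro nn_integral_mono ennreal_leI) (simp add: abs_mult mult_right_mono)
  then show "(\<integral>\<^sup>+ z. ennreal (norm (\<psi> (z - t) * p z)) \<partial>lborel) < \<infinity>"
    using nn_integral_env_finite by (rule le_less_trans)
qed

definition Psi :: "real \<Rightarrow> real" where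
  "Psi t = (\<integral>z. \<psi> (z - t) * p z \<partial>lborel)"

definition Psi_deriv :: real where
  "Psi_deriv = (\<integral>y. p y \<partial>\<mu>)"

definition window :: "real \<Rightarrow> real \<Rightarrow> real \<Rightarrow> ennreal" where
  "window s t y = (\<integral>\<^sup>+ z. indicator {y + s..<y + t} z * ennreal (p z) \<partial>lborel)"

definition local_var_mu :: "real \<Rightarrow> ennreal" where
  "local_var_mu v = (\<integral>\<^sup>+ y. local_var v y \<partial>\<mu>)"

lemma nn_integral_psi_diff_eq_window:
  assumes st: "s \<le> t"
  shows "(\<integral>\<^sup>+ z. ennreal ((\<psi> (z - t) - \<psi> (z - s)) * p z) \<partial>lborel) =
         (\<integral>\<^sup>+ y. window s t y \<partial>\<mu>)"
proof -
  interpret pair_sigma_finite \<mu> lborel by (rule pair_sigma_finite_mu)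
  let ?f = "\<lambda>y z. indicator {x. snd x - t < fst x \<and> fst x \<le> snd x - s} (y,z) * ennreal (p z)"
  have m: "(\<lambda>(y,z). ?f y z) \<in> borel_measurable (\<mu> \<Otimes>\<^sub>M lborel)" by measurable
  have "(\<integral>\<^sup>+ z. ennreal ((\<psi> (z - t) - \<psi> (z - s)) * p z) \<partial>lborel) = (\<integral>\<^sup>+ z. (\<integral>\<^sup>+ y. ?f y z \<partial>\<mu>) \<partial>lborel)"
  proof (intro nn_integral_cong)
    fix z
    have "(\<integral>\<^sup>+ y. ?f y z \<partial>\<mu>) = (\<integral>\<^sup>+ y. ennreal (p z) * indicator {z - t<..z - s} y \<partial>\<mu>)"
      by (intro nn_integral_cong) (auto split: split_indicator)
    also have "\<dots> = ennreal (p z) * emeasure \<mu> {z - t<..z - s}"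
      by (rule nn_integral_cmult_indicator) simp
    also have "\<dots> = ennreal (p z) * ennreal (\<psi> (z - t) - \<psi> (z - s))"
      using st by (simp add: emeasure_mu_Ioc)
    also have "\<dots> = ennreal ((\<psi> (z - t) - \<psi> (z - s)) * p z)"
      using p_nonneg[of z] psi_le[of "z - t" "z - s"] st by (simp add: ennreal_mult mult.commute)
    finally show "ennreal ((\<psi> (z - t) - \<psi> (z - s)) * p z) = (\<integral>\<^sup>+ y. ?f y z \<partial>\<mu>)" by simp
  qed
  also have "\<dots> = (\<integral>\<^sup>+ y. (\<integral>\<^sup>+ z. ?f y z \<partial>lborel) \<partial>\<mu>)"
    by (rule Fubini'[OF m])
  also have "\<dots> = (\<integral>\<^sup>+ y. window s t y \<partial>\<mu>)"
    unfolding window_def by (intro nn_integral_cong) (auto split: split_indicator)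
  finally show ?thesis .
qed

lemma local_var_mu_eq: "local_var_mu v = (\<integral>\<^sup>+ z. ennreal \<bar>dp z\<bar> * emeasure \<mu> (ball z v - {z}) \<partial>lborel)"
proof -
  interpret pair_sigma_finite \<mu> lborel by (rule pair_sigma_finite_mu)
  let ?f = "\<lambda>(y::real) (w::real). indicator {x::real\<times>real. dist (fst x) (snd x) < v \<and> fst x \<noteq> snd x} (y,w) * ennreal \<bar>dp w\<bar>"
  have m: "(\<lambda>(y,z). ?f y z) \<in> borel_measurable (\<mu> \<Otimes>\<^sub>M lborel)" by measurable
  have "local_var_mu v = (\<integral>\<^sup>+ y. (\<integral>\<^sup>+ w. ?f y w \<partial>lborel) \<partial>\<mu>)"
    unfolding local_var_mu_def local_var_def
  proof (rule nn_integral_cong, rule nn_integral_cong_AE)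
    fix y :: real
    have "AE w in lborel. w \<noteq> y"
      by (rule AE_not_in[of "{y}", simplified]) (simp add: countable_imp_null_set_lborel)
    then show "AE w in lborel. indicator (ball y v) w * ennreal \<bar>dp w\<bar> = ?f y w"
      by eventually_elim (auto split: split_indicator simp: dist_commute)
  qed
  also have "\<dots> = (\<integral>\<^sup>+ w. (\<integral>\<^sup>+ y. ?f y w \<partial>\<mu>) \<partial>lborel)"
    by (rule Fubini'[OF m, symmetric])
  also have "\<dots> = (\<integral>\<^sup>+ z. ennreal \<bar>dp z\<bar> * emeasure \<mu> (ball z v - {z}) \<partial>lborel)"
  proof (intro nn_integral_cong)
    fix w :: real
    have "(\<integral>\<^sup>+ y. ?f y w \<partial>\<mu>) = (\<integral>\<^sup>+ y. ennreal \<bar>dp w\<bar> * indicator (ball w v - {w}) y \<partial>\<mu>)"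
      by (intro nn_integral_cong) (auto split: split_indicator simp: dist_commute)
    also have "\<dots> = ennreal \<bar>dp w\<bar> * emeasure \<mu> (ball w v - {w})"
      by (rule nn_integral_cmult_indicator) simp
    finally show "(\<integral>\<^sup>+ y. ?f y w \<partial>\<mu>) = ennreal \<bar>dp w\<bar> * emeasure \<mu> (ball w v - {w})" .
  qed
  finally show ?thesis .
qed

lemma emeasure_punctured_ball_le_env:
  assumes "0 < v" "v \<le> t0"
  shows "emeasure \<mu> (ball z v - {z}) \<le> ennreal (env z)"
proof -
  have "emeasure \<mu> (ball z v - {z}) \<le> emeasure \<mu> {z - v<..z + v}"
    by (intro emeasure_mono) (auto simp: dist_real_def)
  also have "\<dots> = ennreal (\<psi> (z - v) - \<psi> (z + v))" using assms by (intro emeasure_mu_Ioc) simp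
  also have "\<dots> \<le> ennreal (env z)"
  proof (intro ennreal_leI)
    have "\<psi> (z - v) \<le> \<psi> (z - t0)" "\<psi> (z + t0) \<le> \<psi> (z + v)" using assms by (auto intro!: psi_le)
    then show "\<psi> (z - v) - \<psi> (z + v) \<le> env z" unfolding env_def by linarith
  qed
  finally show ?thesis .
qed

lemma local_var_mu_le:
  assumes "0 < v" "v \<le> t0"
  shows "local_var_mu v \<le> (\<integral>\<^sup>+z. ennreal (\<bar>dp z\<bar> * env z) \<partial>lborel)"
  unfolding local_var_mu_eq
proof (intro nn_integral_mono)
  fix z
  have "ennreal \<bar>dp z\<bar> * emeasure \<mu> (ball z v - {z}) \<le> ennreal \<bar>dp z\<bar> * ennreal (env z)"
    by (intro mult_left_mono emeasure_punctured_ball_le_env assms) auto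
  then show "ennreal \<bar>dp z\<bar> * emeasure \<mu> (ball z v - {z}) \<le> ennreal (\<bar>dp z\<bar> * env z)"
    using env_nonneg[of z] by (simp add: ennreal_mult)
qed

lemma local_var_mu_finite: "0 < v \<Longrightarrow> v \<le> t0 \<Longrightarrow> local_var_mu v < \<infinity>"
  using local_var_mu_le nn_integral_abs_dp_env_finite by (rule le_less_trans)

lemma window_measurable [measurable]: "window s t \<in> borel_measurable borel"
proof -
  have "(\<lambda>(y,z). indicator {x::real\<times>real. fst x + s \<le> snd x \<and> snd x < fst x + t} (y,z) * ennreal (p z)) \<in> borel_measurable (borel \<Otimes>\<^sub>M lborel)"
    by measurable
  then have "(\<lambda>y. \<integral>\<^sup>+ z. indicator {x::real\<times>real. fst x + s \<le> snd x \<and> snd x < fst x + t} (y,z) * ennreal (p z) \<partial>lborel) \<in> borel_measurable borel"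
    by (rule lborel.borel_measurable_nn_integral)
  moreover have "(\<lambda>y. \<integral>\<^sup>+ z. indicator {x::real\<times>real. fst x + s \<le> snd x \<and> snd x < fst x + t} (y,z) * ennreal (p z) \<partial>lborel) = window s t"
    unfolding window_def by (intro ext nn_integral_cong) (auto split: split_indicator)
  ultimately show ?thesis by simp
qed

lemma window_le:
  assumes "s \<le> t" "\<bar>s\<bar> \<le> v" "\<bar>t\<bar> \<le> v" "dist y a \<le> v"
  shows "window s t y \<le> ennreal (t - s) * (ennreal (p a) + local_var v y)"
proof -
  have "window s t y \<le> (\<integral>\<^sup>+ z. (ennreal (p a) + local_var v y) * indicator {y+s..<y+t} z \<partial>lborel)"
    unfolding window_def
  proof (intro nn_integral_mono)
    fix z
    show "indicator {y+s..<y+t} z * ennreal (p z) \<le> (ennreal (p a) + local_var v y) * indicator {y+s..<y+t} z"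
    proof (cases "z \<in> {y+s..<y+t}")
      case True
      then have "dist y z \<le> v" using assms by (auto simp: dist_real_def)
      then have "ennreal \<bar>p z - p a\<bar> \<le> local_var v y" using abs_diff_le_local_var[OF assms(4)] by blast
      then have "ennreal (p z) \<le> ennreal (p a) + local_var v y"
        using ennreal_le_add_abs_diff[of "p z" "p a"] by (meson add_left_mono order_trans)
      then show ?thesis using True by simp
    qed simp
  qed
  also have "\<dots> = (ennreal (p a) + local_var v y) * ennreal (t - s)"
    using assms by (subst nn_integral_cmult_indicator) auto
  finally show ?thesis by (simp add: mult.commute)
qed

lemma window_ge:
  assumes "s \<le> t" "\<bar>s\<bar> \<le> v" "\<bar>t\<bar> \<le> v" "dist y a \<le> v"
  shows "ennreal (t - s) * ennreal (p a) \<le> window s t y + ennreal (t - s) * local_var v y"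
proof -
  have "ennreal (t - s) * ennreal (p a) = (\<integral>\<^sup>+ z. ennreal (p a) * indicator {y+s..<y+t} z \<partial>lborel)"
    using assms by (subst nn_integral_cmult_indicator) (auto simp: mult.commute)
  also have "\<dots> \<le> (\<integral>\<^sup>+ z. indicator {y+s..<y+t} z * ennreal (p z) + local_var v y * indicator {y+s..<y+t} z \<partial>lborel)"
  proof (intro nn_integral_mono)
    fix z
    show "ennreal (p a) * indicator {y+s..<y+t} z \<le> indicator {y+s..<y+t} z * ennreal (p z) + local_var v y * indicator {y+s..<y+t} z"
    proof (cases "z \<in> {y+s..<y+t}")
      case True
      then have "dist y z \<le> v" using assms by (auto simp: dist_real_def)
      then have "ennreal \<bar>p a - p z\<bar> \<le> local_var v y" using abs_diff_le_local_var[OF _ assms(4)] by blast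
      then have "ennreal (p a) \<le> ennreal (p z) + local_var v y"
        using ennreal_le_add_abs_diff[of "p a" "p z"] by (meson add_left_mono order_trans)
      then show ?thesis using True by simp
    qed simp
  qed
  also have "\<dots> = window s t y + local_var v y * ennreal (t - s)"
    unfolding window_def using assms
    by (subst nn_integral_add) (auto simp: nn_integral_cmult_indicator)
  finally show ?thesis by (simp add: mult.commute)
qed

lemma nn_integral_window_eq:
  assumes "s \<le> t" "\<bar>s\<bar> \<le> t0" "\<bar>t\<bar> \<le> t0"
  shows "(\<integral>\<^sup>+ y. window s t y \<partial>\<mu>) = ennreal (Psi t - Psi s)" "Psi s \<le> Psi t"
proof -
  have i: "integrable lborel (\<lambda>z. (\<psi> (z - t) - \<psi> (z - s)) * p z)"
    using integrable_psi_shift[OF assms(3)] integrable_psi_shift[OF assms(2)] by (simp add: left_diff_distrib)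
  have nn: "0 \<le> (\<psi> (z - t) - \<psi> (z - s)) * p z" for z
    using psi_le[of "z - t" "z - s"] assms(1) p_nonneg[of z] by simp
  have "(\<integral>z. (\<psi> (z - t) - \<psi> (z - s)) * p z \<partial>lborel) = Psi t - Psi s"
    unfolding Psi_def using integrable_psi_shift[OF assms(3)] integrable_psi_shift[OF assms(2)]
    by (simp add: left_diff_distrib)
  moreover have "(\<integral>\<^sup>+ z. ennreal ((\<psi> (z - t) - \<psi> (z - s)) * p z) \<partial>lborel) = ennreal (\<integral>z. (\<psi> (z - t) - \<psi> (z - s)) * p z \<partial>lborel)"
    using nn_integral_eq_integral[OF i] nn by simp
  moreover have "0 \<le> (\<integral>z. (\<psi> (z - t) - \<psi> (z - s)) * p z \<partial>lborel)"
    using nn by (intro integral_nonneg_AE) auto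
  ultimately show "(\<integral>\<^sup>+ y. window s t y \<partial>\<mu>) = ennreal (Psi t - Psi s)" "Psi s \<le> Psi t"
    using nn_integral_psi_diff_eq_window[OF assms(1)] unfolding window_def by auto
qed

lemma nn_integral_p_shift_mu_finite:
  assumes "\<bar>t\<bar> \<le> t0"
  shows "(\<integral>\<^sup>+ y. ennreal (p (y - t)) \<partial>\<mu>) < \<infinity>"
proof -
  have "(\<integral>\<^sup>+ y. ennreal (2 * t0) * ennreal (p (y - t)) \<partial>\<mu>) \<le>
        (\<integral>\<^sup>+ y. window (-t0) t0 y + ennreal (2 * t0) * local_var t0 y \<partial>\<mu>)"
  proof (intro nn_integral_mono)
    fix y
    have "ennreal (t0 - - t0) * ennreal (p (y - t)) \<le> window (-t0) t0 y + ennreal (t0 - - t0) * local_var t0 y"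
      using assms t0_pos by (intro window_ge) (auto simp: dist_real_def)
    then show "ennreal (2 * t0) * ennreal (p (y - t)) \<le> window (-t0) t0 y + ennreal (2 * t0) * local_var t0 y"
      by simp
  qed
  also have "\<dots> = (\<integral>\<^sup>+ y. window (-t0) t0 y \<partial>\<mu>) + ennreal (2 * t0) * local_var_mu t0"
    unfolding local_var_mu_def by (subst nn_integral_add) (auto simp: nn_integral_cmult)
  also have "\<dots> < \<infinity>"
    using nn_integral_window_eq[of "-t0" t0] t0_pos local_var_mu_finite[of t0] by (simp add: ennreal_mult_less_top less_top)
  finally have "ennreal (2 * t0) * (\<integral>\<^sup>+ y. ennreal (p (y - t)) \<partial>\<mu>) < \<infinity>"
    by (subst (asm) nn_integral_cmult) auto
  then have "(\<integral>\<^sup>+ y. ennreal (p (y - t)) \<partial>\<mu>) = 0 \<or> (\<integral>\<^sup>+ y. ennreal (p (y - t)) \<partial>\<mu>) < top"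
    using t0_pos by (simp add: ennreal_mult_less_top)
  then show ?thesis by auto
qed

lemma integrable_p_shift_mu:
  assumes "\<bar>t\<bar> \<le> t0"
  shows "integrable \<mu> (\<lambda>y. p (y - t))"
  unfolding integrable_iff_bounded
proof
  show "(\<lambda>y. p (y - t)) \<in> borel_measurable \<mu>" by measurable
  show "(\<integral>\<^sup>+ y. ennreal (norm (p (y - t))) \<partial>\<mu>) < \<infinity>"
    using nn_integral_p_shift_mu_finite[OF assms] p_nonneg by simp
qed

lemma Psi_deriv_eq: "ennreal Psi_deriv = (\<integral>\<^sup>+ y. ennreal (p y) \<partial>\<mu>)" "Psi_deriv \<ge> 0"
proof -
  have i: "integrable \<mu> p" using integrable_p_shift_mu[of 0] t0_pos by simp
  show "ennreal Psi_deriv = (\<integral>\<^sup>+ y. ennreal (p y) \<partial>\<mu>)"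
    unfolding Psi_deriv_def using nn_integral_eq_integral[OF i] p_nonneg by simp
  show "Psi_deriv \<ge> 0" unfolding Psi_deriv_def using p_nonneg by (simp add: integral_nonneg_AE)
qed

lemma diff_quotient_bound_less:
  assumes "0 < v" "v \<le> t0" "s < t" "\<bar>s\<bar> \<le> v" "\<bar>t\<bar> \<le> v"
  shows "\<bar>(Psi t - Psi s) / (t - s) - Psi_deriv\<bar> \<le> enn2real (local_var_mu v)"
proof -
  have st: "\<bar>s\<bar> \<le> t0" "\<bar>t\<bar> \<le> t0" using assms by auto
  have Pf: "local_var_mu v < \<infinity>" using local_var_mu_finite assms by auto
  define Q where "Q = Psi t - Psi s"
  have Q: "(\<integral>\<^sup>+ y. window s t y \<partial>\<mu>) = ennreal Q" "Q \<ge> 0" unfolding Q_def using nn_integral_window_eq[OF _ st] assms by auto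
  have R_eq: "local_var_mu v = ennreal (enn2real (local_var_mu v))" using Pf by simp
  define R where "R = enn2real (local_var_mu v)"
  have R: "local_var_mu v = ennreal R" "R \<ge> 0" unfolding R_def using R_eq by auto
  have up: "ennreal Q \<le> ennreal (t - s) * (ennreal Psi_deriv + ennreal R)"
  proof -
    have "(\<integral>\<^sup>+ y. window s t y \<partial>\<mu>) \<le> (\<integral>\<^sup>+ y. ennreal (t - s) * (ennreal (p y) + local_var v y) \<partial>\<mu>)"
      using assms by (intro nn_integral_mono window_le) auto
    also have "\<dots> = ennreal (t - s) * ((\<integral>\<^sup>+ y. ennreal (p y) \<partial>\<mu>) + local_var_mu v)"
      unfolding local_var_mu_def by (subst nn_integral_cmult) (auto simp: nn_integral_add)
    finally show ?thesis using Q Psi_deriv_eq R by simp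
  qed
  have lo: "ennreal (t - s) * ennreal Psi_deriv \<le> ennreal Q + ennreal (t - s) * ennreal R"
  proof -
    have "ennreal (t - s) * ennreal Psi_deriv = (\<integral>\<^sup>+ y. ennreal (t - s) * ennreal (p y) \<partial>\<mu>)"
      using Psi_deriv_eq by (subst nn_integral_cmult) auto
    also have "\<dots> \<le> (\<integral>\<^sup>+ y. window s t y + ennreal (t - s) * local_var v y \<partial>\<mu>)"
      using assms by (intro nn_integral_mono window_ge) auto
    also have "\<dots> = (\<integral>\<^sup>+ y. window s t y \<partial>\<mu>) + ennreal (t - s) * local_var_mu v"
      unfolding local_var_mu_def by (subst nn_integral_add) (auto simp: nn_integral_cmult)
    finally show ?thesis using Q R by simp
  qed
  have ts: "t - s > 0" using assms by simp
  have e1: "ennreal (t - s) * (ennreal Psi_deriv + ennreal R) = ennreal ((t - s) * (Psi_deriv + R))"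
    using ts Psi_deriv_eq(2) R(2) by (simp add: ennreal_mult ennreal_plus)
  have e2: "ennreal (t - s) * ennreal Psi_deriv = ennreal ((t - s) * Psi_deriv)"
    using ts Psi_deriv_eq(2) by (simp add: ennreal_mult)
  have e3: "ennreal Q + ennreal (t - s) * ennreal R = ennreal (Q + (t - s) * R)"
    using ts Q(2) R(2) by (simp add: ennreal_mult ennreal_plus)
  have up': "Q \<le> (t - s) * (Psi_deriv + R)"
  proof -
    have "0 \<le> (t - s) * (Psi_deriv + R)" using ts Psi_deriv_eq(2) R(2) by simp
    then show ?thesis using up unfolding e1 by simp
  qed
  have lo': "(t - s) * Psi_deriv \<le> Q + (t - s) * R"
  proof -
    have "0 \<le> Q + (t - s) * R" using ts Q(2) R(2) by simp
    then show ?thesis using lo unfolding e2 e3 by simp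
  qed
  have "Q / (t - s) - Psi_deriv \<le> R" using up' ts by (simp add: field_simps)
  moreover have "Psi_deriv - Q / (t - s) \<le> R" using lo' ts by (simp add: field_simps)
  ultimately show ?thesis unfolding Q_def R_def by linarith
qed

lemma diff_quotient_bound:
  assumes "0 < v" "v \<le> t0" "s \<noteq> t" "\<bar>s\<bar> \<le> v" "\<bar>t\<bar> \<le> v"
  shows "\<bar>(Psi t - Psi s) / (t - s) - Psi_deriv\<bar> \<le> enn2real (local_var_mu v)"
proof (cases "s < t")
  case True then show ?thesis using diff_quotient_bound_less assms by auto
next
  case False
  then have "t < s" using assms by simp
  then have "\<bar>(Psi s - Psi t) / (s - t) - Psi_deriv\<bar> \<le> enn2real (local_var_mu v)" using diff_quotient_bound_less assms by auto
  moreover have "(Psi s - Psi t) / (s - t) = (Psi t - Psi s) / (t - s)"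
    by (metis minus_diff_eq minus_divide_divide)
  ultimately show ?thesis by simp
qed

lemma mu_integral_shift_bound:
  assumes "0 < \<bar>t\<bar>" "\<bar>t\<bar> \<le> t0"
  shows "\<bar>(\<integral>y. p (y - t) \<partial>\<mu>) - Psi_deriv\<bar> \<le> enn2real (local_var_mu \<bar>t\<bar>)"
proof -
  have i1: "integrable \<mu> (\<lambda>y. p (y - t))" using integrable_p_shift_mu assms by simp
  have i0: "integrable \<mu> p" using integrable_p_shift_mu[of 0] t0_pos by simp
  have "ennreal \<bar>(\<integral>y. p (y - t) \<partial>\<mu>) - Psi_deriv\<bar> = ennreal (norm (\<integral>y. p (y - t) - p y \<partial>\<mu>))"
    unfolding Psi_deriv_def using i1 i0 by simp
  also have "\<dots> \<le> (\<integral>\<^sup>+ y. norm (p (y - t) - p y) \<partial>\<mu>)"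
    by (rule integral_norm_bound_ennreal) (use i1 i0 in simp)
  also have "\<dots> \<le> (\<integral>\<^sup>+ y. local_var \<bar>t\<bar> y \<partial>\<mu>)"
  proof (intro nn_integral_mono)
    fix y
    show "ennreal (norm (p (y - t) - p y)) \<le> local_var \<bar>t\<bar> y"
      using abs_diff_le_local_var[of y y "\<bar>t\<bar>" "y - t"] by (simp add: dist_real_def)
  qed
  also have "\<dots> = ennreal (enn2real (local_var_mu \<bar>t\<bar>))"
    unfolding local_var_mu_def[symmetric] using local_var_mu_finite[of "\<bar>t\<bar>"] assms by simp
  finally have "ennreal \<bar>(\<integral>y. p (y - t) \<partial>\<mu>) - Psi_deriv\<bar> \<le> ennreal (enn2real (local_var_mu \<bar>t\<bar>))" .
  then show ?thesis using enn2real_nonneg[of "local_var_mu \<bar>t\<bar>"] by simp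
qed


lemma local_var_mu_tendsto_0: "(local_var_mu \<longlongrightarrow> 0) (at_right 0)"
proof -
  have [measurable]: "(\<lambda>z. emeasure \<mu> (ball z v - {z})) \<in> borel_measurable borel" for v
  proof -
    let ?Q = "{x \<in> space (borel \<Otimes>\<^sub>M \<mu>). dist (fst x) (snd x) < v \<and> fst x \<noteq> snd x}"
    have "(\<lambda>z. emeasure \<mu> (Pair z -` ?Q)) \<in> borel_measurable borel"
      by (rule sigma_finite_measure.measurable_emeasure_Pair[OF sigma_finite_mu]) measurable
    moreover have "Pair z -` ?Q = ball z v - {z}" for z
      by (auto simp: space_pair_measure)
    ultimately show ?thesis
      by simp
  qed
  have "((\<lambda>v. \<integral>\<^sup>+ z. ennreal \<bar>dp z\<bar> * emeasure \<mu> (ball z v - {z}) \<partial>lborel) \<longlongrightarrow> (\<integral>\<^sup>+ z. 0 \<partial>(lborel :: real measure)))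
      (at_right 0)"
  proof (rule nn_integral_dominated_convergence_at[where w="\<lambda>z. ennreal (\<bar>dp z\<bar> * env z)"])
    show "\<forall>\<^sub>F v in at_right 0. AE z in lborel.
        ennreal \<bar>dp z\<bar> * emeasure \<mu> (ball z v - {z}) \<le> ennreal (\<bar>dp z\<bar> * env z)"
      using eventually_at_right_real[OF t0_pos]
    proof eventually_elim
      case (elim v)
      show ?case
      proof (rule AE_I2)
        fix z
        have "ennreal \<bar>dp z\<bar> * emeasure \<mu> (ball z v - {z}) \<le> ennreal \<bar>dp z\<bar> * ennreal (env z)"
          using elim by (intro mult_left_mono emeasure_punctured_ball_le_env) auto
        then show "ennreal \<bar>dp z\<bar> * emeasure \<mu> (ball z v - {z}) \<le> ennreal (\<bar>dp z\<bar> * env z)"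
          using env_nonneg[of z] by (simp add: ennreal_mult)
      qed
    qed
    show "AE z in lborel. ((\<lambda>v. ennreal \<bar>dp z\<bar> * emeasure \<mu> (ball z v - {z})) \<longlongrightarrow> 0) (at_right 0)"
    proof (rule AE_I2)
      fix z
      have "emeasure \<mu> (ball z t0) \<le> emeasure \<mu> {z - t0<..z + t0}"
        by (intro emeasure_mono) (auto simp: dist_real_def)
      also have "\<dots> < \<infinity>"
        using t0_pos by (simp add: emeasure_mu_Ioc)
      finally have "((\<lambda>v. emeasure \<mu> (ball z v - {z})) \<longlongrightarrow> 0) (at_right 0)"
        using t0_pos by (intro emeasure_punctured_ball_tendsto_0) simp_all
      from tendsto_mult_ennreal[OF tendsto_const this]
      show "((\<lambda>v. ennreal \<bar>dp z\<bar> * emeasure \<mu> (ball z v - {z})) \<longlongrightarrow> 0) (at_right 0)"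
        by simp
    qed
  qed (use nn_integral_abs_dp_env_finite in simp_all)
  then show ?thesis
    unfolding local_var_mu_eq[abs_def] by simp
qed

lemma enn2real_local_var_mu_tendsto_0: "((\<lambda>v. enn2real (local_var_mu v)) \<longlongrightarrow> 0) (at_right 0)"
  using tendsto_enn2real[of local_var_mu 0 "at_right 0"] local_var_mu_tendsto_0 by simp

lemma eventually_at_0_small: "\<forall>\<^sub>F t in at (0::real). t \<noteq> 0 \<and> \<bar>t\<bar> < t0"
  unfolding eventually_at using t0_pos by (intro exI[of _ t0]) (auto simp: dist_real_def)

lemma LS_integral_dec_p: "LS_integral_dec \<psi> p = - Psi_deriv"
  unfolding LS_integral_dec_def Psi_deriv_def by simp

lemma Psi_has_derivative: "(Psi has_real_derivative Psi_deriv) (at 0)"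
  unfolding has_field_derivative_iff
proof (rule LIM_zero_cancel, rule Lim_null_comparison)
  show "\<forall>\<^sub>F t in at 0. norm ((Psi t - Psi 0) / (t - 0) - Psi_deriv) \<le> enn2real (local_var_mu \<bar>t\<bar>)"
    using eventually_at_0_small
  proof eventually_elim
    case (elim t)
    then show ?case
      using diff_quotient_bound[of "\<bar>t\<bar>" 0 t] by simp
  qed
  show "((\<lambda>t. enn2real (local_var_mu \<bar>t\<bar>)) \<longlongrightarrow> 0) (at 0)"
    using enn2real_local_var_mu_tendsto_0 filterlim_abs_at_right_0 by (rule filterlim_compose)
qed

lemma LS_integral_dec_shift_tendsto:
  "((\<lambda>t. LS_integral_dec \<psi> (\<lambda>z. p (z - t))) \<longlongrightarrow> LS_integral_dec \<psi> p) (at 0)"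
proof -
  have "((\<lambda>t. (\<integral>y. p (y - t) \<partial>\<mu>) - Psi_deriv) \<longlongrightarrow> 0) (at 0)"
  proof (rule Lim_null_comparison)
    show "\<forall>\<^sub>F t in at 0. norm ((\<integral>y. p (y - t) \<partial>\<mu>) - Psi_deriv) \<le> enn2real (local_var_mu \<bar>t\<bar>)"
      using eventually_at_0_small by eventually_elim (auto intro: mu_integral_shift_bound)
    show "((\<lambda>t. enn2real (local_var_mu \<bar>t\<bar>)) \<longlongrightarrow> 0) (at 0)"
      using enn2real_local_var_mu_tendsto_0 filterlim_abs_at_right_0 by (rule filterlim_compose)
  qed
  then have "((\<lambda>t. \<integral>y. p (y - t) \<partial>\<mu>) \<longlongrightarrow> Psi_deriv) (at 0)"
    by (rule LIM_zero_cancel)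
  then show ?thesis
    unfolding LS_integral_dec_p unfolding LS_integral_dec_def by (intro tendsto_minus)
qed

lemma diff_quotient_sup_tendsto: "((\<lambda>v. SUP st \<in> {(s, t). s \<in> {-v..v} \<and> t \<in> {-v..v} \<and> s \<noteq> t}.
              ereal \<bar>(Psi (snd st) - Psi (fst st)) / (snd st - fst st) + LS_integral_dec \<psi> p\<bar>)
            \<longlongrightarrow> 0) (at_right 0)"
proof -
  let ?S = "\<lambda>v. {(s, t). s \<in> {-v..v} \<and> t \<in> {-v..v} \<and> s \<noteq> t}"
  let ?F = "\<lambda>st. ereal \<bar>(Psi (snd st) - Psi (fst st)) / (snd st - fst st) + LS_integral_dec \<psi> p\<bar>"
  have lim: "((\<lambda>v. enn2real (local_var_mu v)) \<longlongrightarrow> 0) (at_right 0)"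
    by (rule enn2real_local_var_mu_tendsto_0)
  have ev: "\<forall>\<^sub>F v in at_right 0. v \<in> {0<..<t0}" by (rule eventually_at_right_real[OF t0_pos])
  show ?thesis
  proof (rule tendsto_sandwich[of "\<lambda>_. 0" _ _ "\<lambda>v. ereal (enn2real (local_var_mu v))"])
    show "\<forall>\<^sub>F v in at_right 0. 0 \<le> (SUP st \<in> ?S v. ?F st)"
      using ev
    proof eventually_elim
      case (elim v)
      then have "(-v, v) \<in> ?S v" by auto
      then show ?case by (rule SUP_upper2) simp
    qed
    show "\<forall>\<^sub>F v in at_right 0. (SUP st \<in> ?S v. ?F st) \<le> ereal (enn2real (local_var_mu v))"
      using ev
    proof eventually_elim
      case (elim v)
      show ?case
      proof (rule SUP_least)
        fix st assume "st \<in> ?S v"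
        then obtain s t where st: "st = (s, t)" "\<bar>s\<bar> \<le> v" "\<bar>t\<bar> \<le> v" "s \<noteq> t" by auto
        have "\<bar>(Psi t - Psi s) / (t - s) - Psi_deriv\<bar> \<le> enn2real (local_var_mu v)"
          using elim st by (intro diff_quotient_bound) auto
        then show "?F st \<le> ereal (enn2real (local_var_mu v))" unfolding st LS_integral_dec_p by simp
      qed
    qed
    show "((\<lambda>_. 0) \<longlongrightarrow> (0::ereal)) (at_right 0)" by simp
    show "((\<lambda>v. ereal (enn2real (local_var_mu v))) \<longlongrightarrow> 0) (at_right 0)"
      using tendsto_ereal[OF lim] by (simp add: zero_ereal_def)
  qed
qed

lemma psi_isCont_AE: "AE z in lborel. isCont \<psi> z"
proof -
  have "countable {z. \<not> isCont (\<lambda>x. - \<psi> x) z}"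
    by (rule mono_ctble_discont) (auto simp: mono_def psi_le)
  moreover have "{z. \<not> isCont \<psi> z} \<subseteq> {z. \<not> isCont (\<lambda>x. - \<psi> x) z}"
  proof -
    have "isCont \<psi> z" if "isCont (\<lambda>x. - \<psi> x) z" for z using isCont_minus[OF that] by simp
    then show ?thesis by blast
  qed
  ultimately have "countable {z. \<not> isCont \<psi> z}" by (rule countable_subset[rotated])
  then have "{z. \<not> isCont \<psi> z} \<in> null_sets lborel" by (rule countable_imp_null_set_lborel)
  from AE_not_in[OF this] show ?thesis by simp
qed


lemma tendsto_nn_integral_psi_shift_diff_sq:
  "((\<lambda>t. \<integral>\<^sup>+ z. ennreal ((\<psi> (z - t) - \<psi> z)\<^sup>2 * p z) \<partial>lborel) \<longlongrightarrow> 0) (at 0)"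
proof -
  have "((\<lambda>t. \<integral>\<^sup>+ z. ennreal ((\<psi> (z - t) - \<psi> z)\<^sup>2 * p z) \<partial>lborel) \<longlongrightarrow> (\<integral>\<^sup>+ z. 0 \<partial>(lborel :: real measure))) (at 0)"
  proof (rule nn_integral_dominated_convergence_at[where w="\<lambda>z. ennreal (4 * ((env z)\<^sup>2 * p z))"])
    show "\<forall>\<^sub>F t in at 0. AE z in lborel.
        ennreal ((\<psi> (z - t) - \<psi> z)\<^sup>2 * p z) \<le> ennreal (4 * ((env z)\<^sup>2 * p z))"
      using eventually_at_0_small
    proof eventually_elim
      case (elim t)
      show ?case
      proof (rule AE_I2)
        fix z
        have "\<bar>\<psi> (z - t) - \<psi> z\<bar> \<le> 2 * env z"
          using abs_psi_le_env[of t z] abs_psi_le_env[of 0 z] elim t0_pos by simp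
        then have "(\<psi> (z - t) - \<psi> z)\<^sup>2 \<le> (2 * env z)\<^sup>2"
          by (metis abs_ge_zero power2_abs power_mono)
        from mult_right_mono[OF this p_nonneg[of z]]
        have "(\<psi> (z - t) - \<psi> z)\<^sup>2 * p z \<le> 4 * ((env z)\<^sup>2 * p z)"
          by (simp add: power_mult_distrib)
        then show "ennreal ((\<psi> (z - t) - \<psi> z)\<^sup>2 * p z) \<le> ennreal (4 * ((env z)\<^sup>2 * p z))"
          by (rule ennreal_leI)
      qed
    qed
    show "AE z in lborel. ((\<lambda>t. ennreal ((\<psi> (z - t) - \<psi> z)\<^sup>2 * p z)) \<longlongrightarrow> 0) (at 0)"
      using psi_isCont_AE
    proof eventually_elim
      case (elim z)
      have "((\<lambda>t. z - t) \<longlongrightarrow> z) (at 0)"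
        by (auto intro!: tendsto_eq_intros)
      then have "((\<lambda>t. \<psi> (z - t)) \<longlongrightarrow> \<psi> z) (at 0)"
        by (rule isCont_tendsto_compose[OF elim])
      then have "((\<lambda>t. ennreal ((\<psi> (z - t) - \<psi> z)\<^sup>2 * p z)) \<longlongrightarrow> ennreal ((\<psi> z - \<psi> z)\<^sup>2 * p z)) (at 0)"
        by (intro tendsto_intros)
      then show ?case
        by simp
    qed
    show "(\<integral>\<^sup>+ z. ennreal (4 * ((env z)\<^sup>2 * p z)) \<partial>lborel) < \<infinity>"
      using nn_integral_env_sq_finite by (simp add: ennreal_mult' nn_integral_cmult ennreal_mult_less_top)
  qed simp_all
  then show ?thesis
    by simp
qed


lemma nn_integral_psi_shift_excess_le:
  assumes "\<bar>t\<bar> \<le> t0"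
  shows "(\<integral>\<^sup>+ z. ennreal (max 0 ((\<psi> (z - t))\<^sup>2 - M) * p z) \<partial>lborel) \<le>
    (\<integral>\<^sup>+ z. ennreal (max 0 ((env z)\<^sup>2 - M) * p z) \<partial>lborel)"
proof (intro nn_integral_mono ennreal_leI mult_right_mono p_nonneg)
  fix z
  have "\<bar>\<psi> (z - t)\<bar>\<^sup>2 \<le> (env z)\<^sup>2"
    using abs_psi_le_env[OF assms] by (intro power_mono) auto
  then show "max 0 ((\<psi> (z - t))\<^sup>2 - M) \<le> max 0 ((env z)\<^sup>2 - M)"
    by (auto simp: max_def)
qed

lemma nn_integral_psi_sq_sqrt_shift_le:
  assumes "\<bar>t\<bar> \<le> t0" "M \<ge> 0"
  shows "(\<integral>\<^sup>+ z. ennreal ((\<psi> z)\<^sup>2 * (sqrt (p (z + t)) - sqrt (p z))\<^sup>2) \<partial>lborel) \<le>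
    ennreal M * (ennreal \<bar>t\<bar> * (\<integral>\<^sup>+ w. ennreal \<bar>dp w\<bar> \<partial>lborel)) +
    2 * (\<integral>\<^sup>+ z. ennreal (max 0 ((env z)\<^sup>2 - M) * p z) \<partial>lborel)"
proof -
  let ?E = "\<lambda>z. max 0 ((\<psi> z)\<^sup>2 - M)"
  let ?X = "\<integral>\<^sup>+ z. ennreal (max 0 ((env z)\<^sup>2 - M) * p z) \<partial>lborel"
  have "(\<integral>\<^sup>+ z. ennreal ((\<psi> z)\<^sup>2 * (sqrt (p (z + t)) - sqrt (p z))\<^sup>2) \<partial>lborel) \<le>
      (\<integral>\<^sup>+ z. ennreal M * ennreal \<bar>p (z + t) - p z\<bar> + (ennreal (?E z * p (z + t)) + ennreal (?E z * p z)) \<partial>lborel)"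
  proof (intro nn_integral_mono)
    fix z
    have "(\<psi> z)\<^sup>2 * (sqrt (p (z + t)) - sqrt (p z))\<^sup>2 \<le> M * \<bar>p (z + t) - p z\<bar> + ?E z * (p (z + t) + p z)"
      using sqrt_diff_square_le[OF p_nonneg p_nonneg, of "z + t" z] \<open>M \<ge> 0\<close>
      by (intro mult_le_truncation) auto
    also have "\<dots> = M * \<bar>p (z + t) - p z\<bar> + (?E z * p (z + t) + ?E z * p z)"
      by (simp add: algebra_simps)
    finally have "ennreal ((\<psi> z)\<^sup>2 * (sqrt (p (z + t)) - sqrt (p z))\<^sup>2) \<le>
        ennreal (M * \<bar>p (z + t) - p z\<bar> + (?E z * p (z + t) + ?E z * p z))"
      by (rule ennreal_leI)
    also have "\<dots> = ennreal M * ennreal \<bar>p (z + t) - p z\<bar> + (ennreal (?E z * p (z + t)) + ennreal (?E z * p z))"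
      using \<open>M \<ge> 0\<close> p_nonneg[of z] p_nonneg[of "z + t"] by (simp add: ennreal_mult ennreal_plus)
    finally show "ennreal ((\<psi> z)\<^sup>2 * (sqrt (p (z + t)) - sqrt (p z))\<^sup>2) \<le>
        ennreal M * ennreal \<bar>p (z + t) - p z\<bar> + (ennreal (?E z * p (z + t)) + ennreal (?E z * p z))" .
  qed
  also have "\<dots> = ennreal M * (\<integral>\<^sup>+ z. ennreal \<bar>p (z + t) - p z\<bar> \<partial>lborel) +
      ((\<integral>\<^sup>+ z. ennreal (?E z * p (z + t)) \<partial>lborel) + (\<integral>\<^sup>+ z. ennreal (?E z * p z) \<partial>lborel))"
    by (simp add: nn_integral_add nn_integral_cmult)
  also have "\<dots> \<le> ennreal M * (ennreal \<bar>t\<bar> * (\<integral>\<^sup>+ w. ennreal \<bar>dp w\<bar> \<partial>lborel)) + (?X + ?X)"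
  proof (rule add_mono[OF mult_left_mono add_mono])
    show "(\<integral>\<^sup>+ z. ennreal \<bar>p (z + t) - p z\<bar> \<partial>lborel) \<le> ennreal \<bar>t\<bar> * (\<integral>\<^sup>+ w. ennreal \<bar>dp w\<bar> \<partial>lborel)"
      by (rule nn_integral_abs_shift_diff_le)
    have "(\<integral>\<^sup>+ z. ennreal (?E z * p (z + t)) \<partial>lborel) =
        (\<integral>\<^sup>+ z. ennreal (max 0 ((\<psi> (z - t))\<^sup>2 - M) * p z) \<partial>lborel)"
      using nn_integral_real_affine[of "\<lambda>z. ennreal (max 0 ((\<psi> (z - t))\<^sup>2 - M) * p z)" 1 t]
      by (simp add: add.commute)
    also have "\<dots> \<le> ?X"
      using assms(1) by (rule nn_integral_psi_shift_excess_le)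
    finally show "(\<integral>\<^sup>+ z. ennreal (?E z * p (z + t)) \<partial>lborel) \<le> ?X" .
    show "(\<integral>\<^sup>+ z. ennreal (?E z * p z) \<partial>lborel) \<le> ?X"
      using nn_integral_psi_shift_excess_le[of 0] t0_pos by simp
  qed simp
  finally show ?thesis
    by (simp add: mult_2)
qed

lemma tendsto_nn_integral_psi_sq_sqrt_shift:
  "((\<lambda>t. \<integral>\<^sup>+ z. ennreal ((\<psi> z)\<^sup>2 * (sqrt (p (z + t)) - sqrt (p z))\<^sup>2) \<partial>lborel) \<longlongrightarrow> 0) (at 0)"
proof (rule ennreal_tendsto_0I)
  fix e :: real assume "e > 0"
  have "(\<lambda>z. (env z)\<^sup>2) \<in> borel_measurable lborel" "p \<in> borel_measurable lborel"
    by simp_all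
  from nn_integral_excess_less[OF this _ p_nonneg nn_integral_env_sq_finite, of "e / 4"] \<open>e > 0\<close>
  have "\<exists>M. M \<ge> 0 \<and> (\<integral>\<^sup>+ z. ennreal (max 0 ((env z)\<^sup>2 - M) * p z) \<partial>lborel) < ennreal (e / 4)"
    by simp
  then obtain M where "M \<ge> 0 \<and> (\<integral>\<^sup>+ z. ennreal (max 0 ((env z)\<^sup>2 - M) * p z) \<partial>lborel) < ennreal (e / 4)"
    by (rule exE)
  then have "M \<ge> 0" and M: "(\<integral>\<^sup>+ z. ennreal (max 0 ((env z)\<^sup>2 - M) * p z) \<partial>lborel) < ennreal (e / 4)"
    by simp_all
  define K where "K = enn2real (\<integral>\<^sup>+ w. ennreal \<bar>dp w\<bar> \<partial>lborel)"
  have K: "(\<integral>\<^sup>+ w. ennreal \<bar>dp w\<bar> \<partial>lborel) = ennreal K" "K \<ge> 0"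
    unfolding K_def using nn_integral_abs_dp_finite by auto
  define \<delta> where "\<delta> = min t0 (e / (2 * (M * K + 1)))"
  have "M * K + 1 > 0"
    using \<open>M \<ge> 0\<close> K(2) by (simp add: add_nonneg_pos)
  then have "\<delta> > 0"
    unfolding \<delta>_def using t0_pos \<open>e > 0\<close> by simp
  then have "\<forall>\<^sub>F t in at (0::real). \<bar>t\<bar> < \<delta>"
    unfolding eventually_at by (intro exI[of _ \<delta>]) (auto simp: dist_real_def)
  then show "\<forall>\<^sub>F t in at 0. (\<integral>\<^sup>+ z. ennreal ((\<psi> z)\<^sup>2 * (sqrt (p (z + t)) - sqrt (p z))\<^sup>2) \<partial>lborel) \<le> ennreal e"
  proof eventually_elim
    case (elim t)
    let ?X = "\<integral>\<^sup>+ z. ennreal (max 0 ((env z)\<^sup>2 - M) * p z) \<partial>lborel"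
    have "\<bar>t\<bar> \<le> t0"
      using elim unfolding \<delta>_def by simp
    have "M * (\<bar>t\<bar> * K) \<le> \<bar>t\<bar> * (M * K + 1)"
      using \<open>M \<ge> 0\<close> K(2) by (simp add: algebra_simps)
    also have "\<dots> \<le> e / 2"
      using elim \<open>M * K + 1 > 0\<close> unfolding \<delta>_def by (simp add: field_simps)
    finally have MtK: "M * (\<bar>t\<bar> * K) \<le> e / 2" .
    have "(\<integral>\<^sup>+ z. ennreal ((\<psi> z)\<^sup>2 * (sqrt (p (z + t)) - sqrt (p z))\<^sup>2) \<partial>lborel) \<le>
        ennreal M * (ennreal \<bar>t\<bar> * ennreal K) + (?X + ?X)"
      using nn_integral_psi_sq_sqrt_shift_le[OF \<open>\<bar>t\<bar> \<le> t0\<close> \<open>M \<ge> 0\<close>] K(1) by (simp add: mult_2)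
    also have "\<dots> \<le> ennreal (e / 2) + (ennreal (e / 4) + ennreal (e / 4))"
    proof (rule add_mono[OF _ add_mono])
      have "ennreal M * (ennreal \<bar>t\<bar> * ennreal K) = ennreal (M * (\<bar>t\<bar> * K))"
        using \<open>M \<ge> 0\<close> K(2) by (simp add: ennreal_mult)
      then show "ennreal M * (ennreal \<bar>t\<bar> * ennreal K) \<le> ennreal (e / 2)"
        using MtK by (simp add: ennreal_leI)
    qed (use M in simp_all)
    also have "\<dots> = ennreal e"
      using \<open>e > 0\<close> by (simp add: ennreal_plus[symmetric] del: ennreal_plus)
    finally show ?case .
  qed
qed

end

theorem lemma6p28:
  fixes p0 \<psi> :: "real \<Rightarrow> real" and t0 :: real
  assumes p0_nonneg: "\<And>z. p0 z \<ge> 0"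
    and p0_int: "integrable lborel p0"
    and p0_density: "(\<integral>z. p0 z \<partial>lborel) = 1"
    and p0_ac: "abs_continuous p0"
    and fisher: "\<exists>p0'. p0' \<in> borel_measurable borel
                    \<and> (AE z in lborel. (p0 has_real_derivative p0' z) (at z))
                    \<and> fisher_info p0 p0' < \<infinity>"
    and psi_dec: "antimono \<psi>"
    and psi_rc: "\<And>x. continuous (at_right x) \<psi>"
    and t0_pos: "t0 > 0"
    and psi_sq: "\<And>t. t \<in> {-t0, t0} \<Longrightarrow>
                   (\<integral>\<^sup>+ z. ennreal ((\<psi> (z - t))\<^sup>2 * p0 z) \<partial>lborel) < \<infinity>"
  defines "\<Psi> \<equiv> (\<lambda>t. \<integral>z. \<psi> (z - t) * p0 z \<partial>lborel)"
  shows "((\<lambda>t. \<integral>\<^sup>+ z. ennreal ((\<psi> z)\<^sup>2 * (sqrt (p0 (z + t)) - sqrt (p0 z))\<^sup>2) \<partial>lborel)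
            \<longlongrightarrow> 0) (at 0)
      \<and> ((\<lambda>t. \<integral>\<^sup>+ z. ennreal ((\<psi> (z - t) - \<psi> z)\<^sup>2 * p0 z) \<partial>lborel) \<longlongrightarrow> 0) (at 0)
      \<and> (\<forall>t \<in> {-t0..t0}. integrable lborel (\<lambda>z. \<psi> (z - t) * p0 z)
                         \<and> LS_integrable_dec \<psi> (\<lambda>z. p0 (z - t)))
      \<and> ((\<lambda>v. SUP st \<in> {(s, t). s \<in> {-v..v} \<and> t \<in> {-v..v} \<and> s \<noteq> t}.
              ereal \<bar>(\<Psi> (snd st) - \<Psi> (fst st)) / (snd st - fst st) + LS_integral_dec \<psi> p0\<bar>)
            \<longlongrightarrow> 0) (at_right 0)
      \<and> ((\<lambda>t. LS_integral_dec \<psi> (\<lambda>z. p0 (z - t))) \<longlongrightarrow> LS_integral_dec \<psi> p0) (at 0)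
      \<and> (\<Psi> has_real_derivative (- LS_integral_dec \<psi> p0)) (at 0)
      \<and> - LS_integral_dec \<psi> p0 \<ge> 0"
proof -
  obtain dp where "dp \<in> borel_measurable borel" "AE z in lborel. (p0 has_real_derivative dp z) (at z)"
    "fisher_info p0 dp < \<infinity>"
    using fisher by blast
  then interpret fisher_density_psi p0 dp \<psi> t0
    by unfold_locales (use assms in auto)
  have "\<Psi> = Psi"
    unfolding \<Psi>_def Psi_def ..
  then show ?thesis
    using tendsto_nn_integral_psi_sq_sqrt_shift tendsto_nn_integral_psi_shift_diff_sq
      integrable_psi_shift integrable_p_shift_mu diff_quotient_sup_tendsto
      LS_integral_dec_shift_tendsto Psi_has_derivative Psi_deriv_eq(2)
    by (auto simp: LS_integrable_dec_def LS_integral_dec_p)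
qed

end
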